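(* Let $E$ and $F$ be Banach lattices. The following assertions are equivalent: (a) each operator $T: E \to F$ that is both order almost Dunford-Pettis and weak and almost Dunford-Pettis is almost weakly limited; (b) the norm of $E^*$ is order continuous, or $F^*$ has the positive Schur property.
   Context: "Operator" means bounded linear operator; $B_E$ is the closed unit ball of $E$; $E^*$ is the dual Banach lattice of $E$. A subset $A$ of a Banach lattice $F$ is almost Dunford-Pettis (almost DP) if every disjoint weakly null sequence $(f_n)$ in $F^*$ converges to $0$ uniformly on $A$, i.e. $\lim_{n}\sup_{a\in A}|f_n(a)|=0$. An operator $T:E\to F$ is order almost Dunford-Pettis if it carries each order bounded subset of $E$ to an almost DP set in $F$. It is weak and almost Dunford-Pettis if it carries each relatively weakly compact subset of $E$ to an almost DP set in $F$. It is almost weakly limited if $T(B_E)$ is an almost DP set in $F$. The norm of a Banach lattice is order continuous if every net $x_\alpha\downarrow 0$ converges to $0$ in norm. A Banach lattice has the positive Schur property if every weakly null sequence with positive terms is norm null. *)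

theory Defs
  imports "HOL-Analysis.Analysis" "HOL-Library.Lattice_Algebras"
begin

section \<open>Banach lattices\<close>

text \<open>Banach lattices are real. The class axiom on \<open>abs\<close> inherited from
  \<open>lattice_ab_group_add_abs\<close> is \<open>\<bar>x\<bar> = sup x (- x)\<close>.\<close>

class banach_lattice = banach + ordered_real_vector + lattice_ab_group_add_abs +
  assumes norm_mono_abs: "\<bar>x\<bar> \<le> \<bar>y\<bar> \<Longrightarrow> norm x \<le> norm y"

instance real :: banach_lattice
  by standard simp

lemma norm_mono_nonneg: "0 \<le> x \<Longrightarrow> x \<le> y \<Longrightarrow> norm x \<le> norm (y :: 'a::banach_lattice)"
  by (rule norm_mono_abs) (simp add: abs_prts order.trans)

lemma norm_abs_lattice [simp]: "norm \<bar>x\<bar> = norm (x :: 'a::banach_lattice)"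
  by (rule antisym; rule norm_mono_abs) simp_all

section \<open>The dual space as a normed space\<close>

text \<open>A separate type is needed because \<open>'a \<Rightarrow>\<^sub>L real\<close> cannot be made an instance of a
  lattice class without doing so for \<open>'a \<Rightarrow>\<^sub>L 'b\<close>.\<close>

typedef (overloaded) 'a dual_space = "{f :: 'a::real_normed_vector \<Rightarrow> real. bounded_linear f}"
  morphisms dual_apply Dual
  by (blast intro: bounded_linear_zero)

setup_lifting type_definition_dual_space

lemma dual_eqI: "(\<And>x. dual_apply f x = dual_apply g x) \<Longrightarrow> f = g"
  by transfer auto

lemma bounded_linear_dual_apply: "bounded_linear (dual_apply f)"
  by transfer auto

instantiation dual_space :: (real_normed_vector) real_normed_vector
begin

lift_definition norm_dual_space :: "'a dual_space \<Rightarrow> real" is onorm .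

lift_definition minus_dual_space :: "'a dual_space \<Rightarrow> 'a dual_space \<Rightarrow> 'a dual_space"
  is "\<lambda>f g x. f x - g x"
  by (rule bounded_linear_sub)

definition dist_dual_space :: "'a dual_space \<Rightarrow> 'a dual_space \<Rightarrow> real"
  where "dist_dual_space a b = norm (a - b)"

definition [code del]:
  "(uniformity :: ('a dual_space \<times> 'a dual_space) filter) =
     (INF e\<in>{0 <..}. principal {(x, y). dist x y < e})"

definition open_dual_space :: "'a dual_space set \<Rightarrow> bool"
  where [code del]:
    "open_dual_space S = (\<forall>x\<in>S. \<forall>\<^sub>F (x', y) in uniformity. x' = x \<longrightarrow> y \<in> S)"

lift_definition uminus_dual_space :: "'a dual_space \<Rightarrow> 'a dual_space" is "\<lambda>f x. - f x"
  by (rule bounded_linear_minus)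

lift_definition zero_dual_space :: "'a dual_space" is "\<lambda>x. 0"
  by (rule bounded_linear_zero)

lift_definition plus_dual_space :: "'a dual_space \<Rightarrow> 'a dual_space \<Rightarrow> 'a dual_space"
  is "\<lambda>f g x. f x + g x"
  by (rule bounded_linear_add)

lift_definition scaleR_dual_space :: "real \<Rightarrow> 'a dual_space \<Rightarrow> 'a dual_space"
  is "\<lambda>r f x. r *\<^sub>R f x"
  by (metis bounded_linear_compose bounded_linear_scaleR_right)

definition sgn_dual_space :: "'a dual_space \<Rightarrow> 'a dual_space"
  where "sgn_dual_space x = scaleR (inverse (norm x)) x"

instance
  apply standard
  unfolding dist_dual_space_def open_dual_space_def sgn_dual_space_def uniformity_dual_space_def
  apply (rule refl | (transfer, force simp: onorm_triangle onorm_scaleR onorm_eq_0 algebra_simps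
      simp del: real_scaleR_def))+
  done

end

lemma norm_dual_apply: "norm (dual_apply f x) \<le> norm f * norm x"
  by transfer (rule onorm)

lemma norm_dual_bound: "0 \<le> b \<Longrightarrow> (\<And>x. norm (dual_apply f x) \<le> b * norm x) \<Longrightarrow> norm f \<le> b"
  by transfer (rule onorm_bound)

lemma dual_apply_simps [simp]:
  "dual_apply 0 x = 0"
  "dual_apply (f + g) x = dual_apply f x + dual_apply g x"
  "dual_apply (f - g) x = dual_apply f x - dual_apply g x"
  "dual_apply (- f) x = - dual_apply f x"
  "dual_apply (c *\<^sub>R f) x = c * dual_apply f x"
  by (transfer; simp)+

lemma dual_apply_linear [simp]:
  "dual_apply f 0 = 0"
  "dual_apply f (x + y) = dual_apply f x + dual_apply f y"
  "dual_apply f (x - y) = dual_apply f x - dual_apply f y"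
  "dual_apply f (- x) = - dual_apply f x"
  "dual_apply f (c *\<^sub>R x) = c * dual_apply f x"
proof -
  interpret bounded_linear "dual_apply f" by (rule bounded_linear_dual_apply)
  show "dual_apply f 0 = 0"
    "dual_apply f (x + y) = dual_apply f x + dual_apply f y"
    "dual_apply f (x - y) = dual_apply f x - dual_apply f y"
    "dual_apply f (- x) = - dual_apply f x"
    "dual_apply f (c *\<^sub>R x) = c * dual_apply f x"
    by (simp_all add: add diff neg scale zero)
qed

instance dual_space :: (real_normed_vector) banach
proof
  fix X :: "nat \<Rightarrow> 'a dual_space"
  assume X: "Cauchy X"
  define Y where "Y n = Blinfun (dual_apply (X n))" for n
  have Y: "blinfun_apply (Y n) = dual_apply (X n)" for n
    by (simp add: Y_def bounded_linear_Blinfun_apply bounded_linear_dual_apply)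
  have nY: "norm (Y m - Y n) = norm (X m - X n)" for m n
    unfolding norm_blinfun.rep_eq norm_dual_space.rep_eq
    by (intro arg_cong[of _ _ onorm] ext) (simp add: minus_blinfun.rep_eq Y)
  have "Cauchy Y"
    using X by (simp add: Cauchy_def dist_norm nY)
  then obtain L where L: "Y \<longlonglongrightarrow> L"
    using Cauchy_convergent convergent_def by blast
  define M where "M = Dual (blinfun_apply L)"
  have M: "dual_apply M = blinfun_apply L"
    by (simp add: M_def Dual_inverse blinfun.bounded_linear_right)
  have "norm (X n - M) = norm (Y n - L)" for n
    unfolding norm_blinfun.rep_eq norm_dual_space.rep_eq
    by (intro arg_cong[of _ _ onorm] ext) (simp add: minus_blinfun.rep_eq Y M)
  then have "X \<longlonglongrightarrow> M"
    using L by (simp add: tendsto_iff dist_norm)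
  then show "convergent X"
    by (auto simp: convergent_def)
qed

section \<open>The dual Banach lattice\<close>

text \<open>Riesz--Kantorovich: for \<open>x \<ge> 0\<close> the positive part of \<open>f\<close> at \<open>x\<close> is
  \<open>sup {f y | 0 \<le> y \<le> x}\<close>; elsewhere it is determined by linearity.\<close>

definition rk_cone :: "('a::banach_lattice \<Rightarrow> real) \<Rightarrow> 'a \<Rightarrow> real"
  where "rk_cone f x = (SUP y\<in>{0..x}. f y)"

definition rk_pos :: "('a::banach_lattice \<Rightarrow> real) \<Rightarrow> 'a \<Rightarrow> real"
  where "rk_pos f x = rk_cone f (pprt x) - rk_cone f (- nprt x)"

lemma rk_bdd:
  fixes f :: "'a::banach_lattice \<Rightarrow> real"
  assumes "bounded_linear f" shows "bdd_above (f ` {0..x})"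
proof (rule bdd_aboveI2)
  fix y assume "y \<in> {0..x}"
  then have "norm y \<le> norm x" by (auto intro: norm_mono_nonneg)
  then have "onorm f * norm y \<le> onorm f * norm x"
    by (intro mult_left_mono onorm_pos_le assms)
  then show "f y \<le> onorm f * norm x"
    using onorm[OF assms, of y] by simp
qed

lemma rk_upper:
  "bounded_linear f \<Longrightarrow> 0 \<le> y \<Longrightarrow> y \<le> x \<Longrightarrow> f y \<le> rk_cone f x"
  unfolding rk_cone_def by (rule cSUP_upper[OF _ rk_bdd]) auto

lemma rk_least:
  "0 \<le> x \<Longrightarrow> (\<And>y. 0 \<le> y \<Longrightarrow> y \<le> x \<Longrightarrow> f y \<le> b) \<Longrightarrow> rk_cone f x \<le> b"
  unfolding rk_cone_def by (rule cSUP_least) auto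

lemma rk_nonneg: "bounded_linear f \<Longrightarrow> 0 \<le> x \<Longrightarrow> 0 \<le> rk_cone f x"
  using rk_upper[of f 0 x] by (simp add: bounded_linear.linear linear_0)

lemma rk_add:
  assumes f: "bounded_linear f" and x: "0 \<le> x" and y: "0 \<le> y"
  shows "rk_cone f (x + y) = rk_cone f x + rk_cone f y"
proof (rule antisym)
  show "rk_cone f (x + y) \<le> rk_cone f x + rk_cone f y"
  proof (rule rk_least)
    fix z assume z: "0 \<le> z" "z \<le> x + y"
    have "z - inf z x \<le> y"
      using z y by (simp add: algebra_simps add_sup_distrib_left le_supI)
    moreover have "0 \<le> z - inf z x" by (simp only: diff_ge_0_iff_ge) simp
    ultimately have "f (z - inf z x) \<le> rk_cone f y"
      using rk_upper[OF f] by blast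
    moreover have "f (inf z x) \<le> rk_cone f x"
      using z x by (intro rk_upper[OF f]) auto
    ultimately show "f z \<le> rk_cone f x + rk_cone f y"
      using linear_diff[OF bounded_linear.linear[OF f], of z "inf z x"] by linarith
  qed (use x y in simp)
  have "f u + f v \<le> rk_cone f (x + y)" if "0 \<le> u" "u \<le> x" "0 \<le> v" "v \<le> y" for u v
    using rk_upper[OF f, of "u + v" "x + y"] that
    by (simp add: add_mono linear_add[OF bounded_linear.linear[OF f]])
  then have "f u \<le> rk_cone f (x + y) - f v" if "0 \<le> u" "u \<le> x" "0 \<le> v" "v \<le> y" for u v
    using that by (simp add: le_diff_eq)
  then have "rk_cone f x \<le> rk_cone f (x + y) - f v" if "0 \<le> v" "v \<le> y" for v
    using that x by (intro rk_least) auto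
  then have "f v \<le> rk_cone f (x + y) - rk_cone f x" if "0 \<le> v" "v \<le> y" for v
    using that by (simp add: le_diff_eq algebra_simps)
  then have "rk_cone f y \<le> rk_cone f (x + y) - rk_cone f x"
    using y by (intro rk_least) auto
  then show "rk_cone f x + rk_cone f y \<le> rk_cone f (x + y)" by simp
qed

lemma rk_scaleR:
  assumes f: "bounded_linear f" and x: "0 \<le> x" and c: "0 \<le> c"
  shows "rk_cone f (c *\<^sub>R x) = c * rk_cone f x"
proof (cases "c = 0")
  case True
  then show ?thesis
    by (simp add: rk_cone_def linear_0[OF bounded_linear.linear[OF f]])
next
  case False
  have *: "d * rk_cone f z \<le> rk_cone f (d *\<^sub>R z)" if "0 < d" "0 \<le> z" for d z
  proof -
    have "rk_cone f z \<le> rk_cone f (d *\<^sub>R z) / d"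
    proof (rule rk_least)
      fix y assume "0 \<le> y" "y \<le> z"
      then have "f (d *\<^sub>R y) \<le> rk_cone f (d *\<^sub>R z)"
        using that by (intro rk_upper[OF f] scaleR_left_mono scaleR_nonneg_nonneg) auto
      then show "f y \<le> rk_cone f (d *\<^sub>R z) / d"
        using that by (simp add: field_simps linear_cmul[OF bounded_linear.linear[OF f]])
    qed (use that in simp)
    then show ?thesis using that by (simp add: field_simps)
  qed
  have "inverse c * rk_cone f (c *\<^sub>R x) \<le> rk_cone f x"
    using *[of "inverse c" "c *\<^sub>R x"] False c x by (simp add: scaleR_nonneg_nonneg)
  with *[of c x] False c x show ?thesis by (simp add: field_simps)
qed

lemma pprt_minus_nprt: "pprt x - (- nprt x) = (x :: 'a::lattice_ab_group_add)"
  using prts[of x] by simp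

lemma rk_pos_eq:
  assumes f: "bounded_linear f" and u: "0 \<le> u" and v: "0 \<le> v" and x: "x = u - v"
  shows "rk_pos f x = rk_cone f u - rk_cone f v"
proof -
  have "pprt x + v = u + (- nprt x)"
    using pprt_minus_nprt[of x] x by (metis add.commute diff_add_eq diff_eq_eq)
  then have "rk_cone f (pprt x) + rk_cone f v = rk_cone f u + rk_cone f (- nprt x)"
    using u v by (simp flip: rk_add[OF f] del: add_uminus_conv_diff)
  then show ?thesis by (simp add: rk_pos_def)
qed

lemma rk_pos_cone: "bounded_linear f \<Longrightarrow> 0 \<le> x \<Longrightarrow> rk_pos f x = rk_cone f x"
  using rk_pos_eq[of f x 0 x] by (simp add: rk_cone_def linear_0 bounded_linear.linear)

lemma rk_pos_bounded_linear:
  assumes f: "bounded_linear f"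
  shows "bounded_linear (rk_pos f)"
proof (rule bounded_linear_intro[where K = "onorm f"])
  have dec: "0 \<le> pprt x" "0 \<le> - nprt x" "x = pprt x - (- nprt x)" for x :: 'a
    by (simp_all only: pprt_minus_nprt) simp_all
  fix x y :: 'a and c :: real
  show "rk_pos f (x + y) = rk_pos f x + rk_pos f y"
  proof -
    have "rk_pos f (x + y) = rk_cone f (pprt x + pprt y) - rk_cone f ((- nprt x) + (- nprt y))"
    proof (rule rk_pos_eq[OF f])
      show "x + y = pprt x + pprt y - (- nprt x + - nprt y)"
        using prts[of x] prts[of y] by (simp add: algebra_simps) (metis add.assoc add.left_commute)
    qed (intro add_nonneg_nonneg dec)+
    then show ?thesis by (simp only: rk_add[OF f] dec rk_pos_def)
  qed
  show "rk_pos f (c *\<^sub>R x) = c *\<^sub>R rk_pos f x"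
  proof (cases "0 \<le> c")
    case True
    have "rk_pos f (c *\<^sub>R x) = rk_cone f (c *\<^sub>R pprt x) - rk_cone f (c *\<^sub>R (- nprt x))"
      using True by (intro rk_pos_eq[OF f] scaleR_nonneg_nonneg dec)
        (simp_all only: pprt_minus_nprt flip: scaleR_diff_right)
    then show ?thesis using True
      by (simp only: rk_scaleR[OF f] dec rk_pos_def) (simp add: algebra_simps)
  next
    case False
    then have c: "0 \<le> - c" by simp
    have "rk_pos f (c *\<^sub>R x) = rk_cone f ((- c) *\<^sub>R (- nprt x)) - rk_cone f ((- c) *\<^sub>R pprt x)"
    proof (intro rk_pos_eq[OF f] scaleR_nonneg_nonneg dec c)
      have "(- c) *\<^sub>R (- nprt x) - (- c) *\<^sub>R pprt x = c *\<^sub>R (pprt x - (- nprt x))"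
        by (simp add: algebra_simps)
      then show "c *\<^sub>R x = (- c) *\<^sub>R (- nprt x) - (- c) *\<^sub>R pprt x"
        by (simp only: pprt_minus_nprt)
    qed
    then show ?thesis
      by (simp only: rk_scaleR[OF f dec(1) c] rk_scaleR[OF f dec(2) c] rk_pos_def)
        (simp add: algebra_simps)
  qed
  have bd: "rk_cone f z \<le> onorm f * norm x" if "0 \<le> z" "z \<le> \<bar>x\<bar>" for z
  proof (rule rk_least)
    fix y assume "0 \<le> y" "y \<le> z"
    then have "norm y \<le> norm \<bar>x\<bar>"
      using that by (intro norm_mono_nonneg) auto
    then have "onorm f * norm y \<le> onorm f * norm x"
      by (intro mult_left_mono onorm_pos_le f) simp
    then show "f y \<le> onorm f * norm x"
      using onorm[OF f, of y] by simp
  qed (use that in simp)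
  have "pprt x \<le> \<bar>x\<bar>" "- nprt x \<le> \<bar>x\<bar>"
    by (simp_all add: abs_prts)
  then have "rk_cone f (pprt x) \<le> onorm f * norm x" "rk_cone f (- nprt x) \<le> onorm f * norm x"
    using bd dec by blast+
  then show "norm (rk_pos f x) \<le> norm x * onorm f"
    using rk_nonneg[OF f dec(1), of x] rk_nonneg[OF f dec(2), of x]
    by (simp add: rk_pos_def abs_le_iff mult.commute)
qed

lift_definition dual_pos :: "'a::banach_lattice dual_space \<Rightarrow> 'a dual_space" is rk_pos
  by (rule rk_pos_bounded_linear)

instantiation dual_space :: (banach_lattice) lattice
begin

definition less_eq_dual_space :: "'a dual_space \<Rightarrow> 'a dual_space \<Rightarrow> bool"
  where "f \<le> g \<longleftrightarrow> (\<forall>x\<ge>0. dual_apply f x \<le> dual_apply g x)"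

definition less_dual_space :: "'a dual_space \<Rightarrow> 'a dual_space \<Rightarrow> bool"
  where "less_dual_space f g \<longleftrightarrow> f \<le> g \<and> \<not> g \<le> f"

definition sup_dual_space :: "'a dual_space \<Rightarrow> 'a dual_space \<Rightarrow> 'a dual_space"
  where "sup f g = f + dual_pos (g - f)"

definition inf_dual_space :: "'a dual_space \<Rightarrow> 'a dual_space \<Rightarrow> 'a dual_space"
  where "inf f g = f - dual_pos (f - g)"

lemma dual_pos_cone: "0 \<le> x \<Longrightarrow> dual_apply (dual_pos f) x = rk_cone (dual_apply f) x"
  by transfer (rule rk_pos_cone)

lemma dual_pos_upper: "0 \<le> y \<Longrightarrow> y \<le> x \<Longrightarrow> dual_apply f y \<le> dual_apply (dual_pos f) x"
  by (subst dual_pos_cone) (auto intro: rk_upper bounded_linear_dual_apply)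

lemma dual_pos_nonneg: "0 \<le> x \<Longrightarrow> 0 \<le> dual_apply (dual_pos f) x"
  using dual_pos_upper[of 0 x f] by simp

lemma dual_pos_least:
  assumes "\<And>x. 0 \<le> x \<Longrightarrow> dual_apply f x \<le> dual_apply h x" "\<And>x. 0 \<le> x \<Longrightarrow> 0 \<le> dual_apply h x"
    and "0 \<le> x"
  shows "dual_apply (dual_pos f) x \<le> dual_apply h x"
  unfolding dual_pos_cone[OF assms(3)]
proof (rule rk_least[OF assms(3)])
  fix y assume y: "0 \<le> y" "y \<le> x"
  have "dual_apply f y \<le> dual_apply h y" using assms(1) y by blast
  also have "\<dots> \<le> dual_apply h x" using assms(2)[of "x - y"] y by simp
  finally show "dual_apply f y \<le> dual_apply h x" .
qed

instance
proof
  fix f g h :: "'a dual_space"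
  show "(f < g) = (f \<le> g \<and> \<not> g \<le> f)" by (simp add: less_dual_space_def)
  show "f \<le> f" by (simp add: less_eq_dual_space_def)
  show "f \<le> g \<Longrightarrow> g \<le> h \<Longrightarrow> f \<le> h"
    unfolding less_eq_dual_space_def by (meson order_trans)
  show "f = g" if "f \<le> g" "g \<le> f"
  proof (rule dual_eqI)
    fix x
    have eq: "dual_apply f z = dual_apply g z" if "0 \<le> z" for z
      using \<open>f \<le> g\<close> \<open>g \<le> f\<close> that by (simp add: less_eq_dual_space_def order_eq_iff)
    have "dual_apply f (pprt x - (- nprt x)) = dual_apply g (pprt x - (- nprt x))"
      using eq[of "pprt x"] eq[of "- nprt x"] by (simp del: diff_minus_eq_add)
    then show "dual_apply f x = dual_apply g x" by (simp only: pprt_minus_nprt)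
  qed
  show "inf f g \<le> f" "f \<le> sup f g"
    by (auto simp: less_eq_dual_space_def inf_dual_space_def sup_dual_space_def dual_pos_nonneg)
  show "inf f g \<le> g"
    using dual_pos_upper[of x x "f - g" for x]
    by (force simp: less_eq_dual_space_def inf_dual_space_def algebra_simps)
  show "g \<le> sup f g"
    using dual_pos_upper[of x x "g - f" for x]
    by (force simp: less_eq_dual_space_def sup_dual_space_def algebra_simps)
  show "f \<le> inf g h" if "f \<le> g" "f \<le> h"
    using dual_pos_least[of "g - h" "g - f"] that
    by (force simp: less_eq_dual_space_def inf_dual_space_def algebra_simps)
  show "sup g h \<le> f" if "g \<le> f" "h \<le> f"
    using dual_pos_least[of "h - g" "f - g"] that
    by (force simp: less_eq_dual_space_def sup_dual_space_def algebra_simps)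
qed

end

instantiation dual_space :: (banach_lattice) abs
begin

definition abs_dual_space :: "'a dual_space \<Rightarrow> 'a dual_space"
  where "\<bar>f :: 'a dual_space\<bar> = sup f (- f)"

instance ..

end

instance dual_space :: (banach_lattice) banach_lattice
proof
  fix f g h :: "'a dual_space" and a b :: real
  show "f \<le> g \<Longrightarrow> h + f \<le> h + g" by (simp add: less_eq_dual_space_def)
  show "f \<le> g \<Longrightarrow> 0 \<le> a \<Longrightarrow> a *\<^sub>R f \<le> a *\<^sub>R g"
    by (simp add: less_eq_dual_space_def mult_left_mono)
  show "a \<le> b \<Longrightarrow> 0 \<le> f \<Longrightarrow> a *\<^sub>R f \<le> b *\<^sub>R f"
    by (simp add: less_eq_dual_space_def mult_right_mono)
  show "\<bar>f\<bar> = sup f (- f)" by (rule abs_dual_space_def)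
  show "norm f \<le> norm g" if le: "\<bar>f\<bar> \<le> \<bar>g\<bar>"
  proof (rule norm_dual_bound)
    fix x :: 'a
    have f1: "dual_apply f z \<le> dual_apply \<bar>f\<bar> z" "- dual_apply f z \<le> dual_apply \<bar>f\<bar> z"
      if "0 \<le> z" for z
      using that sup_ge1[of f "- f"] sup_ge2[of "- f" f]
      by (auto simp: less_eq_dual_space_def abs_dual_space_def)
    define u v where "u = pprt x" and "v = - nprt x"
    have uv: "0 \<le> u" "0 \<le> v" "x = u - v" "\<bar>x\<bar> = u + v"
      by (simp_all only: u_def v_def pprt_minus_nprt abs_prts) simp_all
    have "\<bar>dual_apply f x\<bar> \<le> dual_apply \<bar>f\<bar> \<bar>x\<bar>"
      using f1[of u] f1[of v] uv by (simp add: abs_le_iff)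
    also have "\<dots> \<le> dual_apply \<bar>g\<bar> \<bar>x\<bar>"
      using le by (simp add: less_eq_dual_space_def)
    also have "\<dots> = dual_apply g \<bar>x\<bar> + rk_cone (dual_apply ((- g) - g)) \<bar>x\<bar>"
      by (simp add: abs_dual_space_def sup_dual_space_def dual_pos_cone)
    also have "\<dots> \<le> norm g * norm x"
    proof -
      have "rk_cone (dual_apply ((- g) - g)) \<bar>x\<bar> \<le> norm g * norm x - dual_apply g \<bar>x\<bar>"
      proof (rule rk_least)
        fix y assume y: "0 \<le> y" "y \<le> \<bar>x\<bar>"
        define w where "w = \<bar>x\<bar> - (y + y)"
        have "0 \<le> y + y \<and> y + y \<le> \<bar>x\<bar> + \<bar>x\<bar>"
          using y by (intro conjI add_nonneg_nonneg add_mono)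
        then have "w \<le> \<bar>x\<bar>" "- w \<le> \<bar>x\<bar>"
          by (simp_all only: w_def diff_le_eq minus_diff_eq le_add_same_cancel1)
        then have "\<bar>w\<bar> \<le> \<bar>x\<bar>" by (simp add: abs_lattice)
        then have "norm w \<le> norm x" by (rule norm_mono_abs)
        then have "norm g * norm w \<le> norm g * norm x" by (simp add: mult_left_mono)
        with norm_dual_apply[of g w] have "dual_apply g w \<le> norm g * norm x" by simp
        then show "dual_apply (- g - g) y \<le> norm g * norm x - dual_apply g \<bar>x\<bar>"
          by (simp add: w_def)
      qed simp
      then show ?thesis by simp
    qed
    finally show "norm (dual_apply f x) \<le> norm g * norm x" by simp
  qed simp
qed

section \<open>Weak topology\<close>

definition weak_topology :: "'a::real_normed_vector topology"
  where "weak_topology = topology_generated_by {dual_apply \<phi> -` U | \<phi> U. open U}"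

definition relatively_weakly_compact :: "'a::real_normed_vector set \<Rightarrow> bool"
  where "relatively_weakly_compact A \<longleftrightarrow> compactin weak_topology (weak_topology closure_of A)"

definition weakly_null :: "(nat \<Rightarrow> 'a::real_normed_vector) \<Rightarrow> bool"
  where "weakly_null x \<longleftrightarrow> (\<forall>\<phi>. (\<lambda>n. dual_apply \<phi> (x n)) \<longlonglongrightarrow> 0)"

section \<open>Properties of Banach lattices\<close>

definition directed_index :: "'i set \<Rightarrow> ('i \<Rightarrow> 'i \<Rightarrow> bool) \<Rightarrow> bool"
  where "directed_index I le \<longleftrightarrow> I \<noteq> {} \<and> (\<forall>i\<in>I. le i i) \<and>
    (\<forall>i\<in>I. \<forall>j\<in>I. \<forall>k\<in>I. le i j \<longrightarrow> le j k \<longrightarrow> le i k) \<and>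
    (\<forall>i\<in>I. \<forall>j\<in>I. \<exists>k\<in>I. le i k \<and> le j k)"

definition net_decreases_to_zero ::
    "'i set \<Rightarrow> ('i \<Rightarrow> 'i \<Rightarrow> bool) \<Rightarrow> ('i \<Rightarrow> 'a::banach_lattice) \<Rightarrow> bool"
  where "net_decreases_to_zero I le x \<longleftrightarrow>
    (\<forall>i\<in>I. \<forall>j\<in>I. le i j \<longrightarrow> x j \<le> x i) \<and>
    (\<forall>i\<in>I. 0 \<le> x i) \<and> (\<forall>z. (\<forall>i\<in>I. z \<le> x i) \<longrightarrow> z \<le> 0)"

definition net_norm_null ::
    "'i set \<Rightarrow> ('i \<Rightarrow> 'i \<Rightarrow> bool) \<Rightarrow> ('i \<Rightarrow> 'a::real_normed_vector) \<Rightarrow> bool"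
  where "net_norm_null I le x \<longleftrightarrow>
    (\<forall>e>0. \<exists>i\<in>I. \<forall>j\<in>I. le i j \<longrightarrow> norm (x j) < e)"

text \<open>HOL cannot quantify over index types inside a definition, so the nets are indexed by directed
  sets of elements of \<open>'a\<close>. The lemma \<open>order_continuous_normD\<close> shows that this covers nets over
  arbitrary index types.\<close>

definition order_continuous_norm :: "'a::banach_lattice itself \<Rightarrow> bool"
  where "order_continuous_norm TYPE('a) \<longleftrightarrow>
    (\<forall>(I :: 'a set) le (x :: 'a \<Rightarrow> 'a).
      directed_index I le \<longrightarrow> net_decreases_to_zero I le x \<longrightarrow> net_norm_null I le x)"

lemma order_continuous_normD:
  fixes I :: "'i set" and x :: "'i \<Rightarrow> 'a::banach_lattice"
  assumes "order_continuous_norm TYPE('a)" and dir: "directed_index I le"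
    and dec: "net_decreases_to_zero I le x"
  shows "net_norm_null I le x"
proof -
  have mono: "\<And>i j. i \<in> I \<Longrightarrow> j \<in> I \<Longrightarrow> le i j \<Longrightarrow> x j \<le> x i"
    using dec by (auto simp: net_decreases_to_zero_def)
  have "\<exists>k\<in>I. x k \<le> x i \<and> x k \<le> x j" if "i \<in> I" "j \<in> I" for i j
  proof -
    from dir that obtain k where "k \<in> I" "le i k" "le j k"
      unfolding directed_index_def by blast
    then show ?thesis using mono that by blast
  qed
  then have "\<forall>a\<in>x ` I. \<forall>b\<in>x ` I. \<exists>c\<in>x ` I. c \<le> a \<and> c \<le> b"
    by blast
  then have "directed_index (x ` I) (\<lambda>a b. b \<le> a)"
    using dir unfolding directed_index_def
    by (intro conjI ballI impI) (assumption | simp | (erule (1) order_trans[rotated]) | blast)+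
  moreover have "net_decreases_to_zero (x ` I) (\<lambda>a b. b \<le> a) (\<lambda>a. a)"
    using dec by (auto simp: net_decreases_to_zero_def)
  ultimately have "net_norm_null (x ` I) (\<lambda>a b. b \<le> a) (\<lambda>a. a)"
    using assms(1) by (auto simp: order_continuous_norm_def)
  then have "\<exists>i\<in>I. \<forall>j\<in>I. x j \<le> x i \<longrightarrow> norm (x j) < e" if "e > 0" for e
    using that unfolding net_norm_null_def by blast
  then show ?thesis
    using mono unfolding net_norm_null_def by meson
qed

definition positive_schur :: "'a::banach_lattice itself \<Rightarrow> bool"
  where "positive_schur TYPE('a) \<longleftrightarrow>
    (\<forall>x :: nat \<Rightarrow> 'a. weakly_null x \<longrightarrow> (\<forall>n. 0 \<le> x n) \<longrightarrow> x \<longlonglongrightarrow> 0)"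

definition disjoint_seq :: "(nat \<Rightarrow> 'a::banach_lattice) \<Rightarrow> bool"
  where "disjoint_seq x \<longleftrightarrow> (\<forall>m n. m \<noteq> n \<longrightarrow> inf \<bar>x m\<bar> \<bar>x n\<bar> = 0)"

section \<open>Almost Dunford-Pettis sets and operators\<close>

definition almost_DP_set :: "'a::banach_lattice set \<Rightarrow> bool"
  where "almost_DP_set A \<longleftrightarrow>
    (\<forall>f :: nat \<Rightarrow> 'a dual_space. disjoint_seq f \<longrightarrow> weakly_null f \<longrightarrow>
      uniform_limit A (\<lambda>n. dual_apply (f n)) (\<lambda>_. 0) sequentially)"

definition order_bounded :: "'a::banach_lattice set \<Rightarrow> bool"
  where "order_bounded A \<longleftrightarrow> (\<exists>a b. A \<subseteq> {a..b})"

definition order_almost_DP :: "('a::banach_lattice \<Rightarrow>\<^sub>L 'b::banach_lattice) \<Rightarrow> bool"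
  where "order_almost_DP T \<longleftrightarrow> (\<forall>A. order_bounded A \<longrightarrow> almost_DP_set (blinfun_apply T ` A))"

definition weak_and_almost_DP :: "('a::banach_lattice \<Rightarrow>\<^sub>L 'b::banach_lattice) \<Rightarrow> bool"
  where "weak_and_almost_DP T \<longleftrightarrow>
    (\<forall>A. relatively_weakly_compact A \<longrightarrow> almost_DP_set (blinfun_apply T ` A))"

definition almost_weakly_limited :: "('a::banach_lattice \<Rightarrow>\<^sub>L 'b::banach_lattice) \<Rightarrow> bool"
  where "almost_weakly_limited T \<longleftrightarrow> almost_DP_set (blinfun_apply T ` cball 0 1)"

end

theory Submission
  imports Defs
begin

text \<open>Everything rests on components: for \<open>\<phi> \<ge> 0\<close> in the dual and disjoint \<open>w m \<ge> 0\<close>,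
  the functionals \<open>\<phi> m x = sup {\<phi> (inf x (t w m)) | t \<ge> 0}\<close> (\<open>x \<ge> 0\<close>)
  add up to at most \<open>\<phi>\<close>, and \<open>\<phi> m\<close> agrees with \<open>\<phi>\<close> at \<open>w m\<close> and vanishes at the other \<open>w k\<close>. They replace every use of the Hahn--Banach
  theorem. The norm of \<open>E\<^sup>*\<close> fails to be order continuous exactly when some bounded disjoint
  positive sequence of \<open>E\<close> is not weakly null.

  If the norm of \<open>E\<^sup>*\<close> is order continuous and \<open>T\<^sup>* f n\<close> is not norm null, then the order
  hypothesis on \<open>T\<close> and a gliding hump give bounded disjoint \<open>v n\<close> with \<open>f n (T (v n))\<close> bounded away
  from zero along a subsequence; as \<open>v\<close> is weakly null, this contradicts the weak hypothesis.
  If \<open>F\<^sup>*\<close> has the positive Schur property, disjoint weakly null sequences of \<open>F\<^sup>*\<close> are norm null.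
  If both fail, there are bounded disjoint \<open>u n\<close> in \<open>E\<close> with \<open>\<phi> (u n) \<ge> d\<close>, and a disjoint weakly
  null \<open>h n\<close> in \<open>F\<^sup>*\<close> with \<open>h n (y n) \<ge> e\<close> for some \<open>y n\<close> in the unit ball of \<open>F\<close>. The operator
  \<open>T x = (\<Sum>m. \<phi> m x *\<^sub>R y m)\<close> factors through \<open>\<ell>\<^sup>1\<close> and is a counterexample, by the Schur
  property of \<open>\<ell>\<^sup>1\<close>.\<close>

section \<open>Disjointness in lattice-ordered groups\<close>

text \<open>The right-hand side is the infimum of \<open>a + b\<close>, \<open>c + b\<close>,
  \<open>a + c\<close> and \<open>c + c\<close>, and each of the last three lies above
  \<open>c\<close>.\<close>

lemma inf_add_le:
  fixes a b c :: "'a::lattice_ab_group_add"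
  assumes "0 \<le> a" "0 \<le> b" "0 \<le> c"
  shows "inf (a + b) c \<le> inf a c + inf b c"
proof -
  have "inf a c + inf b c = inf (inf (a + b) (c + b)) (inf (a + c) (c + c))"
    by (simp add: add_inf_distrib_left add_inf_distrib_right)
  moreover have "c \<le> c + b" "c \<le> a + c" "c \<le> c + c"
    using assms by simp_all
  ultimately show ?thesis
    by (simp only: le_inf_iff inf_le1 simp_thms) (meson inf_le2 order_trans)
qed

lemma disjoint_add:
  fixes a b c :: "'a::lattice_ab_group_add"
  assumes "0 \<le> a" "0 \<le> b" "0 \<le> c" "inf a c = 0" "inf b c = 0"
  shows "inf (a + b) c = 0"
proof (rule antisym)
  show "inf (a + b) c \<le> 0"
    using inf_add_le[of a b c] assms by simp
  show "0 \<le> inf (a + b) c"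
    using assms by (intro le_infI add_nonneg_nonneg)
qed

lemma disjoint_sum:
  fixes a :: "'i \<Rightarrow> 'a::lattice_ab_group_add"
  assumes "finite I" "\<And>i. i \<in> I \<Longrightarrow> 0 \<le> a i" "0 \<le> c" "\<And>i. i \<in> I \<Longrightarrow> inf (a i) c = 0"
  shows "inf (sum a I) c = 0"
  using assms by (induction I rule: finite_induct) (auto simp: inf_absorb1 sum_nonneg disjoint_add)

lemma disjoint_mono:
  fixes a b c d :: "'a::lattice_ab_group_add"
  assumes "inf c d = 0" "0 \<le> a" "a \<le> c" "0 \<le> b" "b \<le> d"
  shows "inf a b = 0"
proof (rule antisym)
  show "inf a b \<le> 0"
    using inf_mono[OF assms(3,5)] assms(1) by simp
qed (use assms in simp)

text \<open>Disjointness turns \<open>a + b = inf a b + sup a b\<close> into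
  \<open>a + b = sup a b\<close>, so the partial sums are suprema of terms below
  \<open>x\<close>.\<close>

lemma sum_disjoint_le:
  fixes a :: "nat \<Rightarrow> 'a::lattice_ab_group_add"
  assumes nn: "\<And>i. 0 \<le> a i" and le: "\<And>i. a i \<le> x"
    and disj: "\<And>i j. i \<noteq> j \<Longrightarrow> inf (a i) (a j) = 0"
  shows "(\<Sum>i<n. a i) \<le> x"
proof (induction n)
  case 0
  show ?case using order_trans[OF nn le] by simp
next
  case (Suc n)
  have "inf (\<Sum>i<n. a i) (a n) = 0"
    by (rule disjoint_sum) (use nn disj in auto)
  then have "(\<Sum>i<n. a i) + a n = sup (\<Sum>i<n. a i) (a n)"
    by (subst add_eq_inf_sup) (simp only: add_0_right)
  also have "\<dots> \<le> x" using Suc le by (rule sup_least)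
  finally show ?case by simp
qed

text \<open>Translate \<open>inf x 0 = nprt x\<close> by \<open>- nprt x\<close>, where
  \<open>x = pprt x + nprt x\<close>.\<close>

lemma pprt_nprt_disjoint: "inf (pprt x) (- nprt x) = (0 :: 'a::lattice_ab_group_add)"
proof -
  have "inf (pprt x + nprt x) 0 = nprt x"
    by (subst prts[symmetric]) (simp add: nprt_def)
  then show ?thesis
    using add_inf_distrib_right[of "pprt x + nprt x" 0 "- nprt x"] by (simp add: add.assoc)
qed

text \<open>Multiplication by a positive scalar is an order isomorphism, with multiplication by
  \<open>inverse c\<close> as its inverse.\<close>

lemma scaleR_inf_distrib:
  fixes a b :: "'a::banach_lattice"
  assumes "0 \<le> c"
  shows "c *\<^sub>R inf a b = inf (c *\<^sub>R a) (c *\<^sub>R b)"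
proof (cases "c = 0")
  case False
  with assms have c: "0 < c" by simp
  have "inverse c *\<^sub>R inf (c *\<^sub>R a) (c *\<^sub>R b) \<le> inverse c *\<^sub>R (c *\<^sub>R a)"
    "inverse c *\<^sub>R inf (c *\<^sub>R a) (c *\<^sub>R b) \<le> inverse c *\<^sub>R (c *\<^sub>R b)"
    using c by (intro scaleR_left_mono; simp)+
  then have "inverse c *\<^sub>R inf (c *\<^sub>R a) (c *\<^sub>R b) \<le> inf a b"
    using c by simp
  then have "c *\<^sub>R (inverse c *\<^sub>R inf (c *\<^sub>R a) (c *\<^sub>R b)) \<le> c *\<^sub>R inf a b"
    using c by (intro scaleR_left_mono) auto
  then have "inf (c *\<^sub>R a) (c *\<^sub>R b) \<le> c *\<^sub>R inf a b"
    using c by simp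
  moreover have "c *\<^sub>R inf a b \<le> inf (c *\<^sub>R a) (c *\<^sub>R b)"
    using c by (auto intro: scaleR_left_mono)
  ultimately show ?thesis by (rule antisym[rotated])
qed simp

lemma disjoint_scaleR:
  fixes a b :: "'a::banach_lattice"
  assumes "0 \<le> a" "0 \<le> b" "inf a b = 0" "0 \<le> s" "0 \<le> t"
  shows "inf (s *\<^sub>R a) (t *\<^sub>R b) = 0"
proof (rule disjoint_mono)
  show "inf (max s t *\<^sub>R a) (max s t *\<^sub>R b) = 0"
    using assms by (simp flip: scaleR_inf_distrib)
qed (use assms in \<open>auto intro: scaleR_right_mono scaleR_nonneg_nonneg\<close>)

lemma pprt_scaleR: "0 \<le> c \<Longrightarrow> pprt (c *\<^sub>R x) = c *\<^sub>R pprt (x :: 'a::banach_lattice)"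
  using scaleR_inf_distrib[of c "- x" 0]
  by (simp only: pprt_def sup_eq_neg_inf scaleR_minus_right minus_zero scaleR_zero_right)

section \<open>Positive functionals\<close>

lemma dual_nonneg: "0 \<le> \<phi> \<Longrightarrow> 0 \<le> x \<Longrightarrow> 0 \<le> dual_apply \<phi> x"
  by (simp add: less_eq_dual_space_def)

lemma dual_mono: "0 \<le> \<phi> \<Longrightarrow> x \<le> y \<Longrightarrow> dual_apply \<phi> x \<le> dual_apply \<phi> y"
  using dual_nonneg[of \<phi> "y - x"] by simp

lemma dual_le: "\<phi> \<le> \<psi> \<Longrightarrow> 0 \<le> x \<Longrightarrow> dual_apply \<phi> x \<le> dual_apply \<psi> x"
  by (simp add: less_eq_dual_space_def)

lemma dual_abs_le:
  assumes "0 \<le> \<phi>" shows "\<bar>dual_apply \<phi> x\<bar> \<le> dual_apply \<phi> \<bar>x\<bar>"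
  using dual_mono[OF assms, of x "\<bar>x\<bar>"] dual_mono[OF assms, of "- x" "\<bar>x\<bar>"]
    abs_ge_self[of x] abs_ge_minus_self[of x]
  by (simp add: abs_le_iff)

lemma dual_le_norm: "norm x \<le> 1 \<Longrightarrow> \<bar>dual_apply \<phi> x\<bar> \<le> norm \<phi>"
  using norm_dual_apply[of \<phi> x] mult_left_mono[of "norm x" 1 "norm \<phi>"] by simp

lemma dual_pos_ge_0: "0 \<le> dual_pos \<phi>"
  by (simp add: less_eq_dual_space_def dual_pos_nonneg)

text \<open>The formula defining \<open>sup\<close> on the dual is asymmetric; evaluating it as
  \<open>sup \<phi> 0\<close> and as \<open>sup 0 \<phi>\<close> gives the Jordan
  decomposition.\<close>

lemma dual_pos_diff: "dual_pos \<phi> - dual_pos (- \<phi>) = \<phi>"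
proof -
  have "sup \<phi> 0 = \<phi> + dual_pos (- \<phi>)" "sup 0 \<phi> = dual_pos \<phi>"
    by (simp_all add: sup_dual_space_def)
  then show ?thesis by (simp add: sup_commute algebra_simps)
qed

lemma dual_pos_eq_pprt: "dual_pos \<phi> = pprt \<phi>"
  using sup_dual_space_def[of 0 \<phi>] by (simp add: pprt_def sup_commute)

text \<open>Every functional is a difference of two positive ones, by
  \<open>dual_pos_diff\<close>.\<close>

lemma weakly_nullI_pos:
  fixes x :: "nat \<Rightarrow> 'a::banach_lattice"
  assumes "\<And>\<phi>. 0 \<le> \<phi> \<Longrightarrow> (\<lambda>n. dual_apply \<phi> (x n)) \<longlonglongrightarrow> 0"
  shows "weakly_null x"
  unfolding weakly_null_def
proof
  fix \<phi> :: "'a dual_space"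
  have "(\<lambda>n. dual_apply (dual_pos \<phi>) (x n) - dual_apply (dual_pos (- \<phi>)) (x n)) \<longlonglongrightarrow> 0 - 0"
    by (intro tendsto_diff assms dual_pos_ge_0)
  then show "(\<lambda>n. dual_apply \<phi> (x n)) \<longlonglongrightarrow> 0"
    by (simp flip: dual_apply_simps(3) add: dual_pos_diff)
qed

text \<open>Evaluation at \<open>x\<close> is a bounded functional on the dual space.\<close>

lemma weakly_null_apply:
  fixes f :: "nat \<Rightarrow> 'a::real_normed_vector dual_space"
  assumes "weakly_null f"
  shows "(\<lambda>n. dual_apply (f n) x) \<longlonglongrightarrow> 0"
proof -
  have "bounded_linear (\<lambda>g. dual_apply g x)"
    by (rule bounded_linear_intro[where K = "norm x"]) (auto simp: norm_dual_apply[simplified])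
  then have "dual_apply (Dual (\<lambda>g. dual_apply g x)) g = dual_apply g x" for g
    by (simp add: Dual_inverse)
  then show ?thesis
    using assms[unfolded weakly_null_def, THEN spec, of "Dual (\<lambda>g. dual_apply g x)"] by simp
qed

lemma weakly_null_scaleR:
  assumes "weakly_null x" "\<And>n. \<bar>c n\<bar> \<le> 1"
  shows "weakly_null (\<lambda>n. c n *\<^sub>R x n)"
  unfolding weakly_null_def
proof
  fix \<phi>
  show "(\<lambda>n. dual_apply \<phi> (c n *\<^sub>R x n)) \<longlonglongrightarrow> 0"
  proof (rule Lim_null_comparison)
    show "(\<lambda>n. \<bar>dual_apply \<phi> (x n)\<bar>) \<longlonglongrightarrow> 0"
      using assms(1) by (simp add: weakly_null_def tendsto_rabs_zero)
    show "\<forall>\<^sub>F n in sequentially. norm (dual_apply \<phi> (c n *\<^sub>R x n)) \<le> \<bar>dual_apply \<phi> (x n)\<bar>"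
      using assms(2) by (auto simp: abs_mult intro!: always_eventually mult_left_le_one_le)
  qed
qed

lemma weakly_null_uminus: "weakly_null x \<Longrightarrow> weakly_null (\<lambda>n. - x n)"
  using weakly_null_scaleR[of x "\<lambda>_. -1"] by simp

lemma weakly_null_mono:
  fixes x y :: "nat \<Rightarrow> 'a::banach_lattice"
  assumes "weakly_null y" "\<And>n. 0 \<le> x n" "\<And>n. x n \<le> y n"
  shows "weakly_null x"
proof (rule weakly_nullI_pos)
  fix \<phi> :: "'a dual_space" assume \<phi>: "0 \<le> \<phi>"
  show "(\<lambda>n. dual_apply \<phi> (x n)) \<longlonglongrightarrow> 0"
  proof (rule Lim_null_comparison)
    show "(\<lambda>n. dual_apply \<phi> (y n)) \<longlonglongrightarrow> 0"
      using assms(1) by (simp add: weakly_null_def)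
    show "\<forall>\<^sub>F n in sequentially. norm (dual_apply \<phi> (x n)) \<le> dual_apply \<phi> (y n)"
      using dual_nonneg[OF \<phi> assms(2)] dual_mono[OF \<phi> assms(3)] by simp
  qed
qed

lemma weakly_null_subseq:
  assumes "weakly_null x" "strict_mono r" shows "weakly_null (\<lambda>n. x (r n))"
  unfolding weakly_null_def
proof
  fix \<phi>
  show "(\<lambda>n. dual_apply \<phi> (x (r n))) \<longlonglongrightarrow> 0"
    using LIMSEQ_subseq_LIMSEQ[OF _ assms(2), of "\<lambda>n. dual_apply \<phi> (x n)" 0] assms(1)
    by (simp add: weakly_null_def o_def)
qed

section \<open>Extension of additive functions from the positive cone\<close>

definition dual_of_cone :: "('a::banach_lattice \<Rightarrow> real) \<Rightarrow> 'a dual_space"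
  where "dual_of_cone p = Dual (\<lambda>x. p (pprt x) - p (- nprt x))"

text \<open>Kantorovich's extension: an additive, positively homogeneous function on the cone
  extends linearly by differences. Domination by \<phi> makes the extension bounded.\<close>

lemma dual_of_cone:
  fixes p :: "'a::banach_lattice \<Rightarrow> real"
  assumes add: "\<And>x y. 0 \<le> x \<Longrightarrow> 0 \<le> y \<Longrightarrow> p (x + y) = p x + p y"
    and scale: "\<And>c x. 0 < c \<Longrightarrow> 0 \<le> x \<Longrightarrow> p (c *\<^sub>R x) = c * p x"
    and nn: "\<And>x. 0 \<le> x \<Longrightarrow> 0 \<le> p x"
    and le: "\<And>x. 0 \<le> x \<Longrightarrow> p x \<le> dual_apply \<phi> x"
    and x: "0 \<le> x"
  shows "dual_apply (dual_of_cone p) x = p x"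
proof -
  define q where "q x = p (pprt x) - p (- nprt x)" for x
  have p0: "p 0 = 0" using add[of 0 0] by simp
  have dec: "0 \<le> pprt x" "0 \<le> - nprt x" "x = pprt x - (- nprt x)" for x :: 'a
    by (simp_all only: pprt_minus_nprt) simp_all
  \<comment> \<open>Additivity makes the value independent of the chosen representation
    \<open>x = u - v\<close>; linearity of \<open>q\<close> follows by choosing convenient
    representations.\<close>
  have q: "q x = p u - p v" if "0 \<le> u" "0 \<le> v" "x = u - v" for x u v
  proof -
    have "pprt x + v = u + (- nprt x)"
      using pprt_minus_nprt[of x] that by (metis add.commute diff_add_eq diff_eq_eq)
    then have "p (pprt x) + p v = p u + p (- nprt x)"
      using that add[OF dec(1) that(2), of x] add[OF that(1) dec(2), of x] by simp
    then show ?thesis by (simp add: q_def)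
  qed
  have "bounded_linear q"
  proof (rule bounded_linear_intro[where K = "norm \<phi>"])
    fix x y :: 'a and c :: real
    have "q (x + y) = p (pprt x + pprt y) - p ((- nprt x) + (- nprt y))"
    proof (rule q)
      show "x + y = pprt x + pprt y - (- nprt x + - nprt y)"
        using prts[of x] prts[of y] by (simp add: algebra_simps) (metis add.assoc add.left_commute)
    qed (intro add_nonneg_nonneg dec)+
    then show "q (x + y) = q x + q y"
      by (simp only: add dec q_def)
    consider "c = 0" | "0 < c" | "c < 0" by linarith
    then show "q (c *\<^sub>R x) = c *\<^sub>R q x"
    proof cases
      case 1
      then show ?thesis by (simp add: q_def)
    next
      case 2
      have "q (c *\<^sub>R x) = p (c *\<^sub>R pprt x) - p (c *\<^sub>R (- nprt x))"
        using 2 by (intro q scaleR_nonneg_nonneg dec)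
          (simp_all only: pprt_minus_nprt flip: scaleR_diff_right)
      then show ?thesis
        by (simp only: scale[OF 2] dec q_def) (simp add: algebra_simps)
    next
      case 3
      then have c: "0 < - c" by simp
      have "q (c *\<^sub>R x) = p ((- c) *\<^sub>R (- nprt x)) - p ((- c) *\<^sub>R pprt x)"
      proof (intro q scaleR_nonneg_nonneg dec less_imp_le[OF c])
        have "(- c) *\<^sub>R (- nprt x) - (- c) *\<^sub>R pprt x = c *\<^sub>R (pprt x - (- nprt x))"
          by (simp add: algebra_simps)
        then show "c *\<^sub>R x = (- c) *\<^sub>R (- nprt x) - (- c) *\<^sub>R pprt x"
          by (simp only: pprt_minus_nprt)
      qed
      then show ?thesis
        by (simp only: scale[OF c] dec q_def) (simp add: algebra_simps)
    qed
    \<comment> \<open>Applied to the positive and the negative part of \<open>x\<close>; as both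
      values are nonnegative, their difference obeys the same bound.\<close>
    have "p z \<le> norm \<phi> * norm x" if "0 \<le> z" "z \<le> \<bar>x\<bar>" for z
    proof -
      have "norm z \<le> norm \<bar>x\<bar>" using that by (intro norm_mono_nonneg)
      then have "norm \<phi> * norm z \<le> norm \<phi> * norm x" by (simp add: mult_left_mono)
      then show ?thesis using le[OF that(1)] norm_dual_apply[of \<phi> z] by simp
    qed
    moreover have "pprt x \<le> \<bar>x\<bar>" "- nprt x \<le> \<bar>x\<bar>"
      by (simp_all add: abs_prts)
    ultimately have "p (pprt x) \<le> norm \<phi> * norm x" "p (- nprt x) \<le> norm \<phi> * norm x"
      using dec by blast+
    then show "norm (q x) \<le> norm x * norm \<phi>"
      using nn[OF dec(1), of x] nn[OF dec(2), of x]
      by (simp add: q_def abs_le_iff mult.commute)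
  qed
  then have "dual_apply (dual_of_cone p) x = q x"
    by (simp add: dual_of_cone_def Dual_inverse flip: q_def)
  also have "\<dots> = p x"
    using x by (simp add: q_def p0)
  finally show ?thesis .
qed

section \<open>The component of a positive functional at a positive vector\<close>

text \<open>For \<open>x \<ge> 0\<close> the value is \<open>\<phi> (P x)\<close>, where \<open>P\<close> is the band projection onto the band
  generated by \<open>w\<close> whenever that projection exists.\<close>

definition comp_cone :: "'a::banach_lattice dual_space \<Rightarrow> 'a \<Rightarrow> 'a \<Rightarrow> real"
  where "comp_cone \<phi> w x = (SUP t\<in>{0..}. dual_apply \<phi> (inf x (t *\<^sub>R w)))"

definition dual_comp :: "'a::banach_lattice dual_space \<Rightarrow> 'a \<Rightarrow> 'a dual_space"
  where "dual_comp \<phi> w = dual_of_cone (comp_cone \<phi> w)"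

context
  fixes \<phi> :: "'a::banach_lattice dual_space" and w :: 'a
  assumes pos: "0 \<le> \<phi>" "0 \<le> w"
begin

lemma comp_cone_upper: "0 \<le> t \<Longrightarrow> dual_apply \<phi> (inf x (t *\<^sub>R w)) \<le> comp_cone \<phi> w x"
  unfolding comp_cone_def
  by (rule cSUP_upper) (auto intro!: bdd_aboveI2[where M = "dual_apply \<phi> x"] dual_mono pos)

lemma comp_cone_least:
  "(\<And>t. 0 \<le> t \<Longrightarrow> dual_apply \<phi> (inf x (t *\<^sub>R w)) \<le> b) \<Longrightarrow> comp_cone \<phi> w x \<le> b"
  unfolding comp_cone_def by (rule cSUP_least) auto

text \<open>The values increase with the multiple of \<open>w\<close>, so the supremum over real
  multiples is a limit along integer ones.\<close>

lemma comp_cone_tendsto: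
  "(\<lambda>k. dual_apply \<phi> (inf x (real k *\<^sub>R w))) \<longlonglongrightarrow> comp_cone \<phi> w x"
proof (rule LIMSEQ_I)
  fix e :: real assume "0 < e"
  then have "comp_cone \<phi> w x - e < comp_cone \<phi> w x" by simp
  then obtain t where t: "0 \<le> t" "comp_cone \<phi> w x - e < dual_apply \<phi> (inf x (t *\<^sub>R w))"
    using comp_cone_least[of x "comp_cone \<phi> w x - e"] by (meson not_less)
  obtain N where N: "t \<le> real N" using real_arch_simple by blast
  have "norm (dual_apply \<phi> (inf x (real k *\<^sub>R w)) - comp_cone \<phi> w x) < e" if "N \<le> k" for k
  proof -
    have "t *\<^sub>R w \<le> real k *\<^sub>R w"
      using N that pos(2) by (intro scaleR_right_mono) auto
    then have "dual_apply \<phi> (inf x (t *\<^sub>R w)) \<le> dual_apply \<phi> (inf x (real k *\<^sub>R w))"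
      by (intro dual_mono pos inf_mono) auto
    then show ?thesis
      using t comp_cone_upper[of "real k" x] by (simp add: abs_real_def)
  qed
  then show "\<exists>N. \<forall>k\<ge>N. norm (dual_apply \<phi> (inf x (real k *\<^sub>R w)) - comp_cone \<phi> w x) < e"
    by blast
qed

text \<open>Subadditivity is \<open>inf_add_le\<close>. Superadditivity holds because the infima of
  \<open>x\<close> and \<open>y\<close> with the same multiple of \<open>w\<close> add up to at most
  the infimum of \<open>x + y\<close> with twice that multiple. For homogeneity the multiple is
  rescaled.\<close>

lemma dual_comp_eq:
  assumes "0 \<le> x" shows "dual_apply (dual_comp \<phi> w) x = comp_cone \<phi> w x"
  unfolding dual_comp_def
proof (rule dual_of_cone)
  fix x y :: 'a assume xy: "0 \<le> x" "0 \<le> y"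
  show "comp_cone \<phi> w (x + y) = comp_cone \<phi> w x + comp_cone \<phi> w y"
  proof (rule antisym)
    show "comp_cone \<phi> w (x + y) \<le> comp_cone \<phi> w x + comp_cone \<phi> w y"
    proof (rule comp_cone_least)
      fix t :: real assume t: "0 \<le> t"
      have "dual_apply \<phi> (inf (x + y) (t *\<^sub>R w)) \<le> dual_apply \<phi> (inf x (t *\<^sub>R w) + inf y (t *\<^sub>R w))"
        using xy t pos by (intro dual_mono inf_add_le scaleR_nonneg_nonneg)
      also have "\<dots> \<le> comp_cone \<phi> w x + comp_cone \<phi> w y"
        using t by (simp add: comp_cone_upper add_mono)
      finally show "dual_apply \<phi> (inf (x + y) (t *\<^sub>R w)) \<le> comp_cone \<phi> w x + comp_cone \<phi> w y" .
    qed
    have "dual_apply \<phi> (inf x (real k *\<^sub>R w)) + dual_apply \<phi> (inf y (real k *\<^sub>R w))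
      \<le> comp_cone \<phi> w (x + y)" for k
    proof -
      have "inf x (real k *\<^sub>R w) + inf y (real k *\<^sub>R w) \<le> inf (x + y) ((real k + real k) *\<^sub>R w)"
        unfolding scaleR_add_left by (intro le_infI add_mono) auto
      then have "dual_apply \<phi> (inf x (real k *\<^sub>R w) + inf y (real k *\<^sub>R w))
          \<le> dual_apply \<phi> (inf (x + y) ((real k + real k) *\<^sub>R w))"
        by (rule dual_mono[OF pos(1)])
      also have "\<dots> \<le> comp_cone \<phi> w (x + y)" by (rule comp_cone_upper) simp
      finally show ?thesis by simp
    qed
    then show "comp_cone \<phi> w x + comp_cone \<phi> w y \<le> comp_cone \<phi> w (x + y)"
      by (intro LIMSEQ_le_const2[OF tendsto_add[OF comp_cone_tendsto comp_cone_tendsto]]) auto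
  qed
next
  have *: "comp_cone \<phi> w (c *\<^sub>R x) \<le> c * comp_cone \<phi> w x" if "0 < c" "0 \<le> x" for c x
  proof (rule comp_cone_least)
    fix t :: real assume t: "0 \<le> t"
    have "inf (c *\<^sub>R x) (t *\<^sub>R w) = c *\<^sub>R inf x ((t / c) *\<^sub>R w)"
      using that by (simp add: scaleR_inf_distrib)
    then show "dual_apply \<phi> (inf (c *\<^sub>R x) (t *\<^sub>R w)) \<le> c * comp_cone \<phi> w x"
      using that t by (simp add: comp_cone_upper)
  qed
  fix c :: real and x :: 'a assume c: "0 < c" "0 \<le> x"
  have "c * comp_cone \<phi> w x \<le> comp_cone \<phi> w (c *\<^sub>R x)"
    using *[of "inverse c" "c *\<^sub>R x"] c by (simp add: field_simps scaleR_nonneg_nonneg)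
  with *[OF c] show "comp_cone \<phi> w (c *\<^sub>R x) = c * comp_cone \<phi> w x" by simp
next
  fix x :: 'a assume "0 \<le> x"
  then show "0 \<le> comp_cone \<phi> w x"
    using comp_cone_upper[of 0 x] by (simp add: inf_absorb2)
next
  fix x :: 'a assume "0 \<le> x"
  show "comp_cone \<phi> w x \<le> dual_apply \<phi> x"
    by (rule comp_cone_least) (auto intro: dual_mono pos)
qed (use assms in simp)

lemma dual_comp_tendsto:
  "0 \<le> x \<Longrightarrow> (\<lambda>k. dual_apply \<phi> (inf x (real k *\<^sub>R w))) \<longlonglongrightarrow> dual_apply (dual_comp \<phi> w) x"
  by (simp add: dual_comp_eq comp_cone_tendsto)

lemma dual_comp_nonneg: "0 \<le> dual_comp \<phi> w"
  unfolding less_eq_dual_space_def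
proof (intro allI impI)
  fix x :: 'a assume "0 \<le> x"
  then show "dual_apply 0 x \<le> dual_apply (dual_comp \<phi> w) x"
    using comp_cone_upper[of 0 x] by (simp add: dual_comp_eq inf_absorb2)
qed

lemma dual_comp_le: "dual_comp \<phi> w \<le> \<phi>"
  by (auto simp: less_eq_dual_space_def dual_comp_eq intro!: comp_cone_least dual_mono pos)

lemma dual_comp_ideal:
  assumes "0 \<le> x" "x \<le> t *\<^sub>R w" "0 \<le> t"
  shows "dual_apply (dual_comp \<phi> w) x = dual_apply \<phi> x"
proof (rule antisym)
  show "dual_apply (dual_comp \<phi> w) x \<le> dual_apply \<phi> x"
    by (rule dual_le[OF dual_comp_le assms(1)])
  show "dual_apply \<phi> x \<le> dual_apply (dual_comp \<phi> w) x"
    using comp_cone_upper[OF assms(3), of x] assms by (simp add: dual_comp_eq inf_absorb1)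
qed

lemma dual_comp_self: "dual_apply (dual_comp \<phi> w) w = dual_apply \<phi> w"
  using dual_comp_ideal[of w 1] pos by simp

text \<open>A vector disjoint from \<open>w\<close> is disjoint from all its multiples, so every
  approximant vanishes.\<close>

lemma dual_comp_disjoint:
  assumes "0 \<le> x" "inf x w = 0"
  shows "dual_apply (dual_comp \<phi> w) x = 0"
proof -
  have "inf x (real k *\<^sub>R w) = 0" for k
    using disjoint_scaleR[of x w 1 "real k"] assms pos by simp
  then have "(\<lambda>_. 0) \<longlonglongrightarrow> dual_apply (dual_comp \<phi> w) x"
    using dual_comp_tendsto[OF assms(1)] by simp
  then show ?thesis by (simp add: LIMSEQ_const_iff)
qed

end

text \<open>For fixed \<open>k\<close> the vectors \<open>inf x (k w i)\<close> are disjoint and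
  below \<open>x\<close>, hence so is their sum; apply \<phi> and let \<open>k\<close> tend to
  infinity.\<close>

lemma sum_dual_comp_le:
  fixes w :: "nat \<Rightarrow> 'a::banach_lattice"
  assumes "0 \<le> \<phi>" "\<And>i. 0 \<le> w i" and disj: "\<And>i j. i \<noteq> j \<Longrightarrow> inf (w i) (w j) = 0" and x: "0 \<le> x"
  shows "(\<Sum>i<n. dual_apply (dual_comp \<phi> (w i)) x) \<le> dual_apply \<phi> x"
proof (rule LIMSEQ_le_const2)
  show "(\<lambda>k. \<Sum>i<n. dual_apply \<phi> (inf x (real k *\<^sub>R w i)))
      \<longlonglongrightarrow> (\<Sum>i<n. dual_apply (dual_comp \<phi> (w i)) x)"
    by (intro tendsto_sum dual_comp_tendsto assms)
  have "(\<Sum>i<n. inf x (real k *\<^sub>R w i)) \<le> x" for k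
  proof (rule sum_disjoint_le)
    fix i j :: nat assume "i \<noteq> j"
    then have "inf (real k *\<^sub>R w i) (real k *\<^sub>R w j) = 0"
      by (intro disjoint_scaleR assms) auto
    then show "inf (inf x (real k *\<^sub>R w i)) (inf x (real k *\<^sub>R w j)) = 0"
      by (rule disjoint_mono) (simp_all add: x assms(2) scaleR_nonneg_nonneg)
  qed (simp_all add: x assms(2) scaleR_nonneg_nonneg)
  then have "dual_apply \<phi> (\<Sum>i<n. inf x (real k *\<^sub>R w i)) \<le> dual_apply \<phi> x" for k
    by (intro dual_mono assms)
  moreover have "dual_apply \<phi> (\<Sum>i<n. inf x (real k *\<^sub>R w i))
      = (\<Sum>i<n. dual_apply \<phi> (inf x (real k *\<^sub>R w i)))" for k
    by (rule linear_sum[OF bounded_linear.linear[OF bounded_linear_dual_apply]])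
  ultimately show "\<exists>N. \<forall>k\<ge>N. (\<Sum>i<n. dual_apply \<phi> (inf x (real k *\<^sub>R w i))) \<le> dual_apply \<phi> x"
    by simp
qed

section \<open>Series of positive functionals\<close>

context
  fixes \<psi> :: "nat \<Rightarrow> 'a::banach_lattice dual_space" and \<phi> :: "'a dual_space"
  assumes nonneg: "\<And>m. 0 \<le> \<psi> m"
    and sum_le: "\<And>n x. 0 \<le> x \<Longrightarrow> (\<Sum>m<n. dual_apply (\<psi> m) x) \<le> dual_apply \<phi> x"
begin

text \<open>This makes \<open>x \<mapsto> (\<psi> m x)\<^sub>m\<close> a bounded map into
  \<open>\<ell>\<^sup>1\<close>.\<close>

lemma sum_abs_dual_le: "(\<Sum>m<n. \<bar>dual_apply (\<psi> m) x\<bar>) \<le> dual_apply \<phi> \<bar>x\<bar>"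
proof -
  have "(\<Sum>m<n. \<bar>dual_apply (\<psi> m) x\<bar>) \<le> (\<Sum>m<n. dual_apply (\<psi> m) \<bar>x\<bar>)"
    by (intro sum_mono dual_abs_le nonneg)
  also have "\<dots> \<le> dual_apply \<phi> \<bar>x\<bar>" by (rule sum_le) simp
  finally show ?thesis .
qed

lemma summable_abs_dual: "summable (\<lambda>m. \<bar>dual_apply (\<psi> m) x\<bar>)"
  by (rule summableI_nonneg_bounded[OF _ sum_abs_dual_le]) simp

lemma suminf_abs_dual_le: "(\<Sum>m. \<bar>dual_apply (\<psi> m) x\<bar>) \<le> dual_apply \<phi> \<bar>x\<bar>"
  by (rule suminf_le_const[OF summable_abs_dual sum_abs_dual_le])

lemma bounded_linear_series:
  fixes y :: "nat \<Rightarrow> 'c::banach"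
  assumes y: "\<And>m. norm (y m) \<le> 1"
  shows summable_series: "summable (\<lambda>m. dual_apply (\<psi> m) x *\<^sub>R y m)"
    and "bounded_linear (\<lambda>x. \<Sum>m. dual_apply (\<psi> m) x *\<^sub>R y m)"
proof -
  have le: "norm (dual_apply (\<psi> m) x *\<^sub>R y m) \<le> \<bar>dual_apply (\<psi> m) x\<bar>" for m x
    using y[of m] by (simp add: mult_left_le)
  have norm_sm: "summable (\<lambda>m. norm (dual_apply (\<psi> m) x *\<^sub>R y m))" for x
    using summable_abs_dual[of x]
    by (rule summable_comparison_test[rotated]) (use le[of _ x] in auto)
  note sm = summable_norm_cancel[OF norm_sm]
  show "summable (\<lambda>m. dual_apply (\<psi> m) x *\<^sub>R y m)" by (rule sm)
  show "bounded_linear (\<lambda>x. \<Sum>m. dual_apply (\<psi> m) x *\<^sub>R y m)"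
  proof (rule bounded_linear_intro[where K = "norm \<phi>"])
    fix x z :: 'a and c :: real
    show "(\<Sum>m. dual_apply (\<psi> m) (x + z) *\<^sub>R y m) =
        (\<Sum>m. dual_apply (\<psi> m) x *\<^sub>R y m) + (\<Sum>m. dual_apply (\<psi> m) z *\<^sub>R y m)"
      by (simp add: scaleR_add_left suminf_add sm)
    show "(\<Sum>m. dual_apply (\<psi> m) (c *\<^sub>R x) *\<^sub>R y m) = c *\<^sub>R (\<Sum>m. dual_apply (\<psi> m) x *\<^sub>R y m)"
      by (simp add: suminf_scaleR_right[OF sm])
    have "norm (\<Sum>m. dual_apply (\<psi> m) x *\<^sub>R y m) \<le> (\<Sum>m. norm (dual_apply (\<psi> m) x *\<^sub>R y m))"
      by (rule summable_norm[OF norm_sm])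
    also have "\<dots> \<le> (\<Sum>m. \<bar>dual_apply (\<psi> m) x\<bar>)"
      by (rule suminf_le[OF le norm_sm summable_abs_dual])
    also have "\<dots> \<le> dual_apply \<phi> \<bar>x\<bar>" by (rule suminf_abs_dual_le)
    also have "\<dots> \<le> norm \<phi> * norm x" using norm_dual_apply[of \<phi> "\<bar>x\<bar>"] by simp
    finally show "norm (\<Sum>m. dual_apply (\<psi> m) x *\<^sub>R y m) \<le> norm x * norm \<phi>"
      by (simp add: mult.commute)
  qed
qed

end

text \<open>The pullback to the space of the functional on \<open>\<ell>\<^sup>1\<close> that a
  bounded sequence \<open>b\<close> defines.\<close>

definition dual_series :: "(nat \<Rightarrow> 'a::real_normed_vector dual_space) \<Rightarrow> (nat \<Rightarrow> real) \<Rightarrow> 'a dual_space"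
  where "dual_series \<psi> b = Dual (\<lambda>x. \<Sum>m. dual_apply (\<psi> m) x * b m)"

lemma dual_series_apply:
  assumes "\<And>m. 0 \<le> \<psi> m"
    and "\<And>n x. 0 \<le> x \<Longrightarrow> (\<Sum>m<n. dual_apply (\<psi> m) x) \<le> dual_apply \<phi> x"
    and "\<And>m. \<bar>b m\<bar> \<le> 1"
  shows "dual_apply (dual_series \<psi> b) x = (\<Sum>m. dual_apply (\<psi> m) x * b m)"
  using bounded_linear_series(2)[of \<psi> \<phi> b] assms by (simp add: dual_series_def Dual_inverse)

text \<open>One functional, the sum of the components of \<phi> at all \<open>pprt (f m)\<close>,
  takes at \<open>f n\<close> the value of \<phi> at \<open>pprt (f n)\<close>: the component at
  \<open>pprt (f m)\<close> vanishes at every negative part and at the positive parts with other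
  indices.\<close>

lemma weakly_null_pprt:
  fixes f :: "nat \<Rightarrow> 'a::banach_lattice"
  assumes disj: "disjoint_seq f" and null: "weakly_null f"
  shows "weakly_null (\<lambda>n. pprt (f n))"
proof (rule weakly_nullI_pos)
  fix \<phi> :: "'a dual_space" assume \<phi>: "0 \<le> \<phi>"
  let ?w = "\<lambda>n. pprt (f n)" and ?v = "\<lambda>n. - nprt (f n)"
  have le: "0 \<le> ?w n" "?w n \<le> \<bar>f n\<bar>" "0 \<le> ?v n" "?v n \<le> \<bar>f n\<bar>" for n
    by (simp_all add: abs_prts)
  have ww: "inf (?w m) (?w n) = 0" and wv: "inf (?w m) (?v n) = 0" if "m \<noteq> n" for m n
    using disj that unfolding disjoint_seq_def by (blast intro: disjoint_mono le)+
  have vw: "inf (?v n) (?w m) = 0" for m n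
    using wv[of m n] pprt_nprt_disjoint[of "f m"] by (cases "m = n") (simp_all add: inf_commute)
  define \<psi> where "\<psi> m = dual_comp \<phi> (?w m)" for m
  have \<psi>: "\<And>m. 0 \<le> \<psi> m" "\<And>n x. 0 \<le> x \<Longrightarrow> (\<Sum>m<n. dual_apply (\<psi> m) x) \<le> dual_apply \<phi> x"
    by (auto simp: \<psi>_def dual_comp_nonneg \<phi> intro!: sum_dual_comp_le ww)
  have "dual_apply (\<psi> m) (f n) = (if m = n then dual_apply \<phi> (?w n) else 0)" for m n
  proof -
    have "dual_apply (\<psi> m) (f n) = dual_apply (\<psi> m) (?w n - ?v n)"
      by (simp only: pprt_minus_nprt)
    also have "\<dots> = dual_apply (\<psi> m) (?w n) - dual_apply (\<psi> m) (?v n)"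
      by (simp only: dual_apply_linear)
    also have "dual_apply (\<psi> m) (?v n) = 0"
      unfolding \<psi>_def by (rule dual_comp_disjoint[OF \<phi> le(1,3) vw])
    also have "dual_apply (\<psi> m) (?w n) = (if m = n then dual_apply \<phi> (?w n) else 0)"
      using dual_comp_self[OF \<phi> le(1)] dual_comp_disjoint[OF \<phi> le(1,1) ww, of n m]
      by (auto simp: \<psi>_def)
    finally show ?thesis by simp
  qed
  then have "dual_apply (dual_series \<psi> (\<lambda>_. 1)) (f n) = (\<Sum>m. if m = n then dual_apply \<phi> (?w n) else 0)" for n
    by (simp add: dual_series_apply[OF \<psi>])
  also have "(\<Sum>m. if m = n then dual_apply \<phi> (?w n) else 0) = dual_apply \<phi> (?w n)" for n
    using sums_single[of n "\<lambda>_. dual_apply \<phi> (?w n)"] by (simp add: sums_iff)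
  finally show "(\<lambda>n. dual_apply \<phi> (?w n)) \<longlonglongrightarrow> 0"
    using null[unfolded weakly_null_def, THEN spec, of "dual_series \<psi> (\<lambda>_. 1)"] by simp
qed

section \<open>Disjoint sequences and order continuity of the dual norm\<close>

text \<open>The tails of the series of components of \<open>\<phi>\<close> at the \<open>x n\<close> decrease to zero.\<close>
lemma order_continuous_dual_imp_weakly_null:
  fixes x :: "nat \<Rightarrow> 'a::banach_lattice"
  assumes oc: "order_continuous_norm TYPE('a dual_space)"
    and x: "\<And>n. 0 \<le> x n" "\<And>n. norm (x n) \<le> 1"
    and disj: "\<And>m n. m \<noteq> n \<Longrightarrow> inf (x m) (x n) = 0"
  shows "weakly_null x"
proof (rule weakly_nullI_pos)
  fix \<phi> :: "'a dual_space" assume \<phi>: "0 \<le> \<phi>"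
  define \<psi> where "\<psi> m = dual_comp \<phi> (x m)" for m
  have \<psi>: "\<And>m. 0 \<le> \<psi> m" "\<And>n x. 0 \<le> x \<Longrightarrow> (\<Sum>m<n. dual_apply (\<psi> m) x) \<le> dual_apply \<phi> x"
    by (auto simp: \<psi>_def dual_comp_nonneg \<phi> x intro!: sum_dual_comp_le disj)
  \<comment> \<open>The tail from index \<open>n\<close> on, written as a \<open>dual_series\<close>
    so that it is a bounded functional by construction.\<close>
  define R where "R n = dual_series \<psi> (\<lambda>m. if m < n then 0 else 1)" for n
  have sm: "summable (\<lambda>m. dual_apply (\<psi> m) y)" for y
    using summable_abs_dual[OF \<psi>] by (rule summable_rabs_cancel)
  have R: "dual_apply (R n) y = (\<Sum>m. dual_apply (\<psi> m) y) - (\<Sum>m<n. dual_apply (\<psi> m) y)" for n y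
  proof -
    let ?b = "\<lambda>m. if m < n then 0 else 1 :: real"
    have s: "summable (\<lambda>m. dual_apply (\<psi> m) y * ?b m)"
      using bounded_linear_series(1)[OF \<psi>, where y = ?b] by simp
    have "dual_apply (R n) y = (\<Sum>m. dual_apply (\<psi> m) y * ?b m)"
      by (simp add: R_def dual_series_apply[OF \<psi>])
    also have "\<dots> = (\<Sum>m. dual_apply (\<psi> (m + n)) y)"
      using suminf_split_initial_segment[OF s, of n] by simp
    also have "\<dots> = (\<Sum>m. dual_apply (\<psi> m) y) - (\<Sum>m<n. dual_apply (\<psi> m) y)"
      using suminf_split_initial_segment[OF sm, of y n] by simp
    finally show ?thesis .
  qed
  have Rnull: "(\<lambda>n. dual_apply (R n) y) \<longlonglongrightarrow> 0" for y
    using tendsto_diff[OF tendsto_const summable_LIMSEQ[OF sm], of "\<Sum>m. dual_apply (\<psi> m) y" y]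
    by (simp add: R)
  have Rge: "dual_apply (\<psi> n) y \<le> dual_apply (R n) y" if "0 \<le> y" for n y
    using sum_le_suminf[OF sm, of "{..<Suc n}" y] dual_nonneg[OF \<psi>(1) that] by (simp add: R)
  have R0: "0 \<le> R n" for n
    using Rge[of _ n] dual_nonneg[OF \<psi>(1)[of n]]
    by (auto simp: less_eq_dual_space_def intro: order_trans)
  have "net_norm_null UNIV (\<le>) R"
  proof (rule order_continuous_normD[OF oc])
    show "directed_index UNIV ((\<le>) :: nat \<Rightarrow> nat \<Rightarrow> bool)"
      unfolding directed_index_def by (auto intro: max.cobounded1 max.cobounded2)
    have "R j \<le> R i" if "i \<le> j" for i j
      using sum_mono2[of "{..<j}" "{..<i}" "\<lambda>m. dual_apply (\<psi> m) y" for y] that dual_nonneg[OF \<psi>(1)]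
      by (auto simp: less_eq_dual_space_def R)
    \<comment> \<open>The tails tend to 0 pointwise, so a common lower bound is at most 0 on the
      cone.\<close>
    moreover have "z \<le> 0" if "\<forall>i. z \<le> R i" for z
      unfolding less_eq_dual_space_def
    proof (intro allI impI)
      fix y :: 'a assume "0 \<le> y"
      then have "dual_apply z y \<le> dual_apply (R n) y" for n
        using that by (simp add: less_eq_dual_space_def)
      then show "dual_apply z y \<le> dual_apply 0 y"
        using LIMSEQ_le_const[OF Rnull[of y], of "dual_apply z y"] by simp
    qed
    ultimately show "net_decreases_to_zero UNIV (\<le>) R"
      by (simp add: net_decreases_to_zero_def R0)
  qed
  then have null: "R \<longlonglongrightarrow> 0"
    unfolding net_norm_null_def LIMSEQ_iff by simp
  \<comment> \<open>The tail \<open>R n\<close> still contains \<open>\<psi> n\<close>, which agrees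
    with \<phi> at \<open>x n\<close>.\<close>
  have "norm (dual_apply \<phi> (x n)) \<le> norm (R n)" for n
    using Rge[OF x(1), of n n] dual_nonneg[OF \<phi> x(1), of n] dual_le_norm[OF x(2), of "R n" n]
    by (simp add: \<psi>_def dual_comp_self[OF \<phi> x(1)])
  then show "(\<lambda>n. dual_apply \<phi> (x n)) \<longlonglongrightarrow> 0"
    by (intro Lim_null_comparison[OF _ tendsto_norm_zero[OF null]]) simp
qed

section \<open>Extraction of disjoint sequences\<close>

lemma banach_lattice_LIMSEQ_nonneg:
  fixes x :: "nat \<Rightarrow> 'a::banach_lattice"
  assumes "x \<longlonglongrightarrow> l" "\<And>n. 0 \<le> x n"
  shows "0 \<le> l"
proof -
  \<comment> \<open>The negative part of the limit is dominated by every difference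
    \<open>x n - l\<close> in modulus, so its norm is 0.\<close>
  have "pprt (- l) \<le> \<bar>x n - l\<bar>" for n
  proof -
    have "- l \<le> x n - l" using assms(2)[of n] by simp
    also have "\<dots> \<le> \<bar>x n - l\<bar>" by (rule abs_ge_self)
    finally show ?thesis by (simp add: pprt_def)
  qed
  then have "norm (pprt (- l)) \<le> norm (x n - l)" for n
    using norm_mono_nonneg[of "pprt (- l)" "\<bar>x n - l\<bar>"] by simp
  moreover have "(\<lambda>n. norm (x n - l)) \<longlonglongrightarrow> 0"
    using assms(1) by (simp add: LIM_zero tendsto_norm_zero)
  ultimately have "norm (pprt (- l)) \<le> 0"
    by (intro LIMSEQ_le_const) auto
  then have "- l \<le> 0" by (simp only: norm_le_zero_iff le_zero_iff_zero_pprt[of "- l"])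
  then show ?thesis by simp
qed

text \<open>The second vector is \<open>inverse c\<close> times the negative part of
  \<open>a - c *\<^sub>R b\<close>, whose positive part is the first.\<close>

lemma disjoint_pprt_pair:
  fixes a b :: "'a::banach_lattice"
  assumes c: "0 < c"
  shows "inf (pprt (a - c *\<^sub>R b)) (pprt (b - inverse c *\<^sub>R a)) = 0"
proof -
  have "b - inverse c *\<^sub>R a = inverse c *\<^sub>R (- (a - c *\<^sub>R b))"
    using c by (simp add: algebra_simps)
  then have "pprt (b - inverse c *\<^sub>R a) = inverse c *\<^sub>R (- nprt (a - c *\<^sub>R b))"
    using c by (simp only: pprt_scaleR pprt_neg less_imp_le inverse_nonnegative_iff_nonnegative)
  then show ?thesis
    using disjoint_scaleR[OF zero_le_pprt _ pprt_nprt_disjoint, where s = 1 and t = "inverse c"] c by simp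
qed

text \<open>Subtracting multiples of the earlier \<open>x i\<close> separates \<open>x (Suc n)\<close> from them; subtracting a small
  multiple of \<open>z = (\<Sum>i. 2\<^sup>-\<^sup>i x i)\<close> separates it from all later ones.\<close>
lemma disjointify:
  fixes x :: "nat \<Rightarrow> 'a::banach_lattice"
  assumes x: "\<And>n. 0 \<le> x n" "\<And>n. norm (x n) \<le> 1" and d: "0 < d"
  shows "\<exists>z\<ge>0. norm z \<le> 2 \<and> (\<forall>m n. m \<noteq> n \<longrightarrow>
    inf (pprt (x (Suc m) - (2 ^ Suc m / d) *\<^sub>R (\<Sum>i\<le>m. x i) - d *\<^sub>R z))
        (pprt (x (Suc n) - (2 ^ Suc n / d) *\<^sub>R (\<Sum>i\<le>n. x i) - d *\<^sub>R z)) = 0)"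
proof -
  define z where "z = (\<Sum>i. (1/2)^i *\<^sub>R x i)"
  have le: "norm ((1/2)^i *\<^sub>R x i) \<le> (1/2)^i" for i
    using x(2)[of i] by (simp add: mult_left_le)
  have geo: "summable (\<lambda>i. (1/2)^i :: real)" by (rule summable_geometric) simp
  have norm_sm: "summable (\<lambda>i. norm ((1/2)^i *\<^sub>R x i))"
    by (rule summable_comparison_test[OF _ geo]) (use le in auto)
  note sm = summable_norm_cancel[OF norm_sm]
  have "norm z \<le> (\<Sum>i. (1/2)^i :: real)"
    unfolding z_def by (rule order_trans[OF summable_norm[OF norm_sm] suminf_le[OF le norm_sm geo]])
  also have "\<dots> = 2" using suminf_geometric[of "1/2::real"] by simp
  finally have "norm z \<le> 2" .
  \<comment> \<open>Partial sums that include the \<open>k\<close>-th term dominate it, and the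
    positive cone is closed.\<close>
  have part: "(1/2)^k *\<^sub>R x k \<le> z" for k
  proof -
    have "0 \<le> (\<Sum>i<n + Suc k. (1/2)^i *\<^sub>R x i) - (1/2)^k *\<^sub>R x k" for n
      using sum_mono2[of "{..<n + Suc k}" "{k}" "\<lambda>i. (1/2)^i *\<^sub>R x i"] x(1)
      by (simp add: scaleR_nonneg_nonneg)
    moreover have "(\<lambda>n. (\<Sum>i<n + Suc k. (1/2)^i *\<^sub>R x i) - (1/2)^k *\<^sub>R x k) \<longlonglongrightarrow> z - (1/2)^k *\<^sub>R x k"
      unfolding z_def
      by (intro tendsto_diff tendsto_const LIMSEQ_ignore_initial_segment summable_LIMSEQ sm)
    ultimately have "0 \<le> z - (1/2)^k *\<^sub>R x k"
      by (rule banach_lattice_LIMSEQ_nonneg[rotated])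
    then show ?thesis by simp
  qed
  have "0 \<le> z" using part[of 0] x(1)[of 0] by (auto intro: order_trans)
  define u where "u n = pprt (x (Suc n) - (2 ^ Suc n / d) *\<^sub>R (\<Sum>i\<le>n. x i) - d *\<^sub>R z)" for n
  have less: "inf (u m) (u n) = 0" if "n < m" for m n
  proof -
    let ?c = "2 ^ Suc m / d"
    have c: "0 < ?c" using d by simp
    \<comment> \<open>From \<open>n < m\<close> the index \<open>Suc n\<close> is at most
      \<open>m\<close>, so the sum subtracted in \<open>u m\<close> contains
      \<open>x (Suc n)\<close>.\<close>
    have "x (Suc n) \<le> (\<Sum>i\<le>m. x i)"
      using sum_mono2[of "{..m}" "{Suc n}" x] x(1) that by simp
    then have "?c *\<^sub>R x (Suc n) \<le> ?c *\<^sub>R (\<Sum>i\<le>m. x i)"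
      using c by (intro scaleR_left_mono) auto
    moreover have "0 \<le> d *\<^sub>R z" using d \<open>0 \<le> z\<close> by (intro scaleR_nonneg_nonneg) auto
    ultimately have um: "u m \<le> pprt (x (Suc m) - ?c *\<^sub>R x (Suc n))"
      unfolding u_def by (intro pprt_mono) (metis add.right_neutral add_mono diff_diff_eq diff_left_mono)
    \<comment> \<open>The factor \<open>2 ^ Suc m / d\<close> is matched to the weights of
      \<open>z\<close>: its inverse times \<open>x (Suc m)\<close> is \<open>d\<close> times one
      term of the series.\<close>
    have "inverse ?c *\<^sub>R x (Suc m) = d *\<^sub>R ((1/2) ^ Suc m *\<^sub>R x (Suc m))"
      by (simp add: field_simps power_divide)
    also have "\<dots> \<le> d *\<^sub>R z" using part[of "Suc m"] d by (intro scaleR_left_mono) auto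
    finally have "inverse ?c *\<^sub>R x (Suc m) \<le> d *\<^sub>R z" .
    moreover have "0 \<le> (2 ^ Suc n / d) *\<^sub>R (\<Sum>i\<le>n. x i)"
      using d x(1) by (intro scaleR_nonneg_nonneg sum_nonneg) auto
    ultimately have "u n \<le> pprt (x (Suc n) - inverse ?c *\<^sub>R x (Suc m))"
      unfolding u_def by (intro pprt_mono) (metis add.left_neutral add_mono diff_diff_eq diff_left_mono)
    then show ?thesis
      using disjoint_mono[OF disjoint_pprt_pair[OF c] _ um] by (simp add: u_def)
  qed
  have "inf (u m) (u n) = 0" if "m \<noteq> n" for m n
    using less[of m n] less[of n m] that by (metis inf_commute linorder_neqE_nat)
  then show ?thesis
    using \<open>0 \<le> z\<close> \<open>norm z \<le> 2\<close> unfolding u_def by blast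
qed

text \<open>Each new functional is chosen almost null on a large multiple of the sum of the vectors
  chosen before. The subtractions made by \<open>disjointify\<close> then cost at most
  \<open>e / 4\<close> each, out of \<open>e\<close>. The relation \<open>R\<close> lets a caller
  with natural-number indices ask for increasing ones.\<close>

lemma gliding_hump_disjoint:
  fixes g :: "'i \<Rightarrow> 'a::banach_lattice dual_space" and R :: "'i \<Rightarrow> 'i \<Rightarrow> bool"
  assumes "I \<noteq> {}" and e: "0 < e"
    and pos: "\<And>i. i \<in> I \<Longrightarrow> 0 \<le> g i" and bound: "\<And>i. i \<in> I \<Longrightarrow> norm (g i) \<le> M"
    and small: "\<And>i s d. i \<in> I \<Longrightarrow> 0 \<le> s \<Longrightarrow> 0 < d \<Longrightarrow> \<exists>j\<in>I. R i j \<and> dual_apply (g j) s < d"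
    and large: "\<And>i. i \<in> I \<Longrightarrow> \<exists>x\<ge>0. norm x \<le> 1 \<and> e \<le> dual_apply (g i) x"
  shows "\<exists>r u. (\<forall>n. r n \<in> I \<and> R (r n) (r (Suc n)) \<and> 0 \<le> u n \<and> norm (u n) \<le> 1 \<and>
      e / 2 \<le> dual_apply (g (r n)) (u n)) \<and> (\<forall>m n. m \<noteq> n \<longrightarrow> inf (u m) (u n) = 0)"
proof -
  have M: "0 \<le> M" using \<open>I \<noteq> {}\<close> bound norm_ge_zero order_trans by blast
  \<comment> \<open>Since \<open>norm z \<le> 2\<close>, this makes the loss caused by
    \<open>d *\<^sub>R z\<close> at most \<open>e / 4\<close>; the summand 1 keeps the denominator
    positive.\<close>
  define d where "d = e / (8 * (M + 1))"
  have d: "0 < d" and dM: "2 * d * M \<le> e / 4"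
    using e M by (auto simp: d_def field_simps)
  \<comment> \<open>The state of the recursion: an index, its vector, and the sum of all vectors
    chosen so far.\<close>
  define P where "P = (\<lambda>(i, x, s :: 'a). i \<in> I \<and> 0 \<le> x \<and> norm x \<le> 1 \<and> e \<le> dual_apply (g i) x \<and> 0 \<le> s)"
  define Q where "Q n = (\<lambda>(i, x :: 'a, s) (j, y, t). R i j \<and> t = s + y \<and>
    dual_apply (g j) ((2 ^ Suc n / d) *\<^sub>R s) < e / 4)" for n :: nat
  obtain i0 x0 where i0: "i0 \<in> I" "0 \<le> x0" "norm x0 \<le> 1" "e \<le> dual_apply (g i0) x0"
    using \<open>I \<noteq> {}\<close> large by blast
  \<comment> \<open>The clause for \<open>n = 0\<close> makes the accumulated sum start as the first
    vector, so that \<open>s n\<close> is the sum of \<open>x i\<close> over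
    \<open>i \<le> n\<close>.\<close>
  have "\<exists>h. \<forall>n. (P (h n) \<and> (n = 0 \<longrightarrow> h n = (i0, x0, x0))) \<and> Q n (h n) (h (Suc n))"
  proof (rule dependent_nat_choice)
    show "\<exists>h. P h \<and> ((0::nat) = 0 \<longrightarrow> h = (i0, x0, x0))" using i0 by (simp add: P_def)
    fix h and n :: nat assume "P h \<and> (n = 0 \<longrightarrow> h = (i0, x0, x0))"
    then obtain i x s where h: "h = (i, x, s)" "i \<in> I" "0 \<le> s" by (auto simp: P_def)
    have "0 \<le> (2 ^ Suc n / d) *\<^sub>R s" using h d by (intro scaleR_nonneg_nonneg) auto
    then obtain j where j: "j \<in> I" "R i j" "dual_apply (g j) ((2 ^ Suc n / d) *\<^sub>R s) < e / 4"
      using small[OF h(2), of "(2 ^ Suc n / d) *\<^sub>R s" "e / 4"] e by auto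
    obtain y where y: "0 \<le> y" "norm y \<le> 1" "e \<le> dual_apply (g j) y"
      using large[OF j(1)] by blast
    have "P (j, y, s + y)" "Q n h (j, y, s + y)"
      using h j y by (auto simp: P_def Q_def)
    then show "\<exists>h'. (P h' \<and> (Suc n = 0 \<longrightarrow> h' = (i0, x0, x0))) \<and> Q n h h'"
      by blast
  qed
  then obtain h where h: "\<And>n. P (h n)" "h 0 = (i0, x0, x0)" "\<And>n. Q n (h n) (h (Suc n))"
    by blast
  define r where "r n = fst (h n)" for n
  define x where "x n = fst (snd (h n))" for n
  define s where "s n = snd (snd (h n))" for n
  have hn: "h n = (r n, x n, s n)" for n by (simp add: r_def x_def s_def)
  have P: "r n \<in> I" "0 \<le> x n" "norm (x n) \<le> 1" "e \<le> dual_apply (g (r n)) (x n)" for n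
    using h(1)[of n] by (simp_all add: P_def hn)
  have Q: "R (r n) (r (Suc n))" "s (Suc n) = s n + x (Suc n)"
    "dual_apply (g (r (Suc n))) ((2 ^ Suc n / d) *\<^sub>R s n) < e / 4" for n
    using h(3)[of n] by (simp_all add: Q_def hn)
  have s: "s n = (\<Sum>i\<le>n. x i)" for n
    by (induction n) (use h(2) in \<open>simp_all add: Q(2) hn\<close>)
  from disjointify[of x, OF P(2,3) d]
  obtain z where z: "0 \<le> z" "norm z \<le> 2" and disj: "\<forall>m n. m \<noteq> n \<longrightarrow>
    inf (pprt (x (Suc m) - (2 ^ Suc m / d) *\<^sub>R (\<Sum>i\<le>m. x i) - d *\<^sub>R z))
        (pprt (x (Suc n) - (2 ^ Suc n / d) *\<^sub>R (\<Sum>i\<le>n. x i) - d *\<^sub>R z)) = 0"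
    by (elim exE conjE) (rule that)
  define u where "u n = pprt (x (Suc n) - (2 ^ Suc n / d) *\<^sub>R s n - d *\<^sub>R z)" for n
  have u0: "0 \<le> u n" for n by (simp add: u_def)
  have "u n \<le> pprt (x (Suc n))" for n
  proof -
    have "0 \<le> (2 ^ Suc n / d) *\<^sub>R s n" "0 \<le> d *\<^sub>R z"
      using d z P(2) by (auto simp: s intro!: scaleR_nonneg_nonneg sum_nonneg)
    then show ?thesis
      unfolding u_def by (intro pprt_mono) (simp add: diff_le_eq add_increasing2 del: scaleR_scaleR)
  qed
  then have "norm (u n) \<le> 1" for n
    using norm_mono_nonneg[OF u0] P(3)[of "Suc n"] P(2)[of "Suc n"] by (metis order_trans pprt_eq_id)
  moreover have "e / 2 \<le> dual_apply (g (r (Suc n))) (u n)" for n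
  proof -
    let ?g = "g (r (Suc n))"
    have "dual_apply ?g (d *\<^sub>R z) \<le> norm ?g * norm (d *\<^sub>R z)"
      using norm_dual_apply[of ?g "d *\<^sub>R z"] by simp
    also have "\<dots> \<le> M * (d * 2)"
      using bound[OF P(1)] z d M by (intro mult_mono) auto
    also have "\<dots> \<le> e / 4" using dM by (simp add: mult_ac)
    finally have "e - e / 4 - e / 4 \<le>
        dual_apply ?g (x (Suc n)) - dual_apply ?g ((2 ^ Suc n / d) *\<^sub>R s n) - dual_apply ?g (d *\<^sub>R z)"
      using P(4)[of "Suc n"] Q(3)[of n] by linarith
    also have "\<dots> = dual_apply ?g (x (Suc n) - (2 ^ Suc n / d) *\<^sub>R s n - d *\<^sub>R z)"
      by simp
    also have "\<dots> \<le> dual_apply ?g (u n)"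
      unfolding u_def by (rule dual_mono[OF pos[OF P(1)]]) (simp add: pprt_def)
    finally show ?thesis by simp
  qed
  moreover have "inf (u m) (u n) = 0" if "m \<noteq> n" for m n
    using disj[rule_format, OF that] by (simp add: u_def s)
  ultimately show ?thesis
    \<comment> \<open>The shift by one is there because \<open>u n\<close> is carved out of
      \<open>x (Suc n)\<close>.\<close>
    by (intro exI[of _ "\<lambda>n. r (Suc n)"] exI[of _ u]) (use P(1) Q(1) u0 in blast)
qed

text \<open>By \<open>\<bar>g x\<bar> \<le> g \<bar>x\<bar>\<close> positive vectors suffice to
  compute the norm. Halving \<open>e\<close> leaves room for a supremum that is not
  attained.\<close>

lemma dual_pos_norm_witness:
  fixes g :: "'a::banach_lattice dual_space"
  assumes "0 \<le> g" "0 < e" "e \<le> norm g"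
  shows "\<exists>x\<ge>0. norm x \<le> 1 \<and> e / 2 \<le> dual_apply g x"
proof (rule ccontr)
  assume "\<not> ?thesis"
  then have less: "dual_apply g x \<le> e / 2" if "0 \<le> x" "norm x \<le> 1" for x
    using that by force
  have "norm g \<le> e / 2"
  proof (rule norm_dual_bound)
    fix x :: 'a
    have "dual_apply g \<bar>x\<bar> \<le> e / 2 * norm x"
    proof (cases "x = 0")
      case False
      have "dual_apply g (inverse (norm x) *\<^sub>R \<bar>x\<bar>) \<le> e / 2"
        using False by (intro less scaleR_nonneg_nonneg) auto
      then show ?thesis using False by (simp add: field_simps)
    qed simp
    then show "norm (dual_apply g x) \<le> e / 2 * norm x"
      using dual_abs_le[OF assms(1), of x] by simp
  qed (use assms in simp)
  then show False using assms by simp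
qed

text \<open>The pointwise infimum of the net on the cone is additive by directedness. It therefore
  extends to a functional below every member, which must be at most 0.\<close>

lemma net_decreases_to_zero_dual:
  fixes x :: "'i \<Rightarrow> 'a::banach_lattice dual_space"
  assumes dir: "directed_index I le" and dec: "net_decreases_to_zero I le x"
    and s: "0 \<le> s" and d: "0 < d"
  shows "\<exists>j\<in>I. dual_apply (x j) s < d"
proof (rule ccontr)
  assume "\<not> ?thesis"
  then have ge: "d \<le> dual_apply (x j) s" if "j \<in> I" for j
    using that by force
  have "I \<noteq> {}" using dir by (simp add: directed_index_def)
  then obtain i0 where i0: "i0 \<in> I" by blast
  have x0: "0 \<le> x i" if "i \<in> I" for i
    using dec that by (simp add: net_decreases_to_zero_def)
  define p where "p y = (INF i\<in>I. dual_apply (x i) y)" for y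
  have lower: "p y \<le> dual_apply (x i) y" if "0 \<le> y" "i \<in> I" for y i
    unfolding p_def using that
    by (intro cINF_lower bdd_belowI2[where m = 0] dual_nonneg x0) auto
  have greatest: "b \<le> p y" if "\<And>i. i \<in> I \<Longrightarrow> b \<le> dual_apply (x i) y" for b y
    unfolding p_def by (rule cINF_greatest[OF \<open>I \<noteq> {}\<close> that])
  have p: "dual_apply (dual_of_cone p) y = p y" if "0 \<le> y" for y
  proof (rule dual_of_cone[OF _ _ _ lower[OF _ i0] that])
    fix a b :: 'a assume ab: "0 \<le> a" "0 \<le> b"
    have "p (a + b) \<le> dual_apply (x i) a + dual_apply (x j) b" if ij: "i \<in> I" "j \<in> I" for i j
    proof -
      obtain k where k: "k \<in> I" "le i k" "le j k"
        using dir ij unfolding directed_index_def by blast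
      then have "x k \<le> x i" "x k \<le> x j"
        using dec ij by (auto simp: net_decreases_to_zero_def)
      then show ?thesis
        using lower[OF add_nonneg_nonneg[OF ab] k(1)] dual_le[of "x k" "x i" a] dual_le[of "x k" "x j" b] ab
        by simp
    qed
    then have "p (a + b) - dual_apply (x i) a \<le> p b" if "i \<in> I" for i
      using that by (intro greatest) (simp add: diff_le_eq add.commute[of "dual_apply _ b"])
    then have "p (a + b) - p b \<le> p a"
      by (intro greatest) (simp add: diff_le_eq add.commute)
    moreover have "p a + p b \<le> p (a + b)"
      by (rule greatest) (simp add: add_mono lower ab)
    ultimately show "p (a + b) = p a + p b" by simp
  next
    fix c :: real and a :: 'a assume c: "0 < c" "0 \<le> a"
    have "c * p a \<le> p (c *\<^sub>R a)"
      using c by (intro greatest) (simp add: lower)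
    moreover have "p (c *\<^sub>R a) / c \<le> p a"
      using c lower[of "c *\<^sub>R a"] by (intro greatest) (simp add: scaleR_nonneg_nonneg field_simps)
    ultimately show "p (c *\<^sub>R a) = c * p a" using c by (simp add: field_simps)
  qed (auto intro!: greatest dual_nonneg x0)
  then have "dual_of_cone p \<le> x i" if "i \<in> I" for i
    using that by (simp add: less_eq_dual_space_def lower)
  then have "dual_of_cone p \<le> 0"
    using dec by (simp add: net_decreases_to_zero_def)
  then have "p s \<le> 0"
    using s p[OF s] by (auto simp: less_eq_dual_space_def)
  moreover have "d \<le> p s" by (rule greatest[OF ge])
  ultimately show False using d by simp
qed

text \<open>A net decreasing to 0 whose norms do not tend to 0 is pointwise null on the cone, so the
  gliding hump applies to it. All functionals found lie below one member \<open>x i0\<close>, which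
  is the required \<phi>.\<close>

lemma not_order_continuous_dual:
  assumes "\<not> order_continuous_norm TYPE('a::banach_lattice dual_space)"
  shows "\<exists>\<phi> (u :: nat \<Rightarrow> 'a) e. 0 \<le> \<phi> \<and> 0 < e \<and> (\<forall>n. 0 \<le> u n \<and> norm (u n) \<le> 1 \<and> e \<le> dual_apply \<phi> (u n))
    \<and> (\<forall>m n. m \<noteq> n \<longrightarrow> inf (u m) (u n) = 0)"
proof -
  obtain I le and x :: "'a dual_space \<Rightarrow> 'a dual_space" where dir: "directed_index I le"
    and dec: "net_decreases_to_zero I le x" and "\<not> net_norm_null I le x"
    using assms unfolding order_continuous_norm_def by blast
  then obtain e where e: "0 < e" and far: "\<And>i. i \<in> I \<Longrightarrow> \<exists>j\<in>I. le i j \<and> e \<le> norm (x j)"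
    unfolding net_norm_null_def by (meson not_le)
  have x0: "0 \<le> x i" if "i \<in> I" for i
    using dec that by (simp add: net_decreases_to_zero_def)
  have mono: "x j \<le> x i" if "i \<in> I" "j \<in> I" "le i j" for i j
    using dec that by (simp add: net_decreases_to_zero_def)
  obtain i0 where i0: "i0 \<in> I" using dir by (auto simp: directed_index_def)
  \<comment> \<open>The restriction bounds the norms by that of \<open>x i0\<close> and keeps the
    functionals below it.\<close>
  define J where "J = {i \<in> I. x i \<le> x i0}"
  have "\<exists>(r :: nat \<Rightarrow> _) u. (\<forall>n. r n \<in> J \<and> True \<and> 0 \<le> u n \<and> norm (u n) \<le> 1 \<and>
      e / 2 / 2 \<le> dual_apply (x (r n)) (u n)) \<and> (\<forall>m n. m \<noteq> n \<longrightarrow> inf (u m) (u n) = 0)"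
  proof (rule gliding_hump_disjoint[where R = "\<lambda>_ _. True"])
    show "J \<noteq> {}" using i0 by (auto simp: J_def)
    show "0 < e / 2" using e by simp
    show "0 \<le> x i" if "i \<in> J" for i using that x0 by (simp add: J_def)
    show "norm (x i) \<le> norm (x i0)" if "i \<in> J" for i
      using that x0 by (intro norm_mono_nonneg) (auto simp: J_def)
    \<comment> \<open>Some later member has norm at least \<open>e\<close>; by monotonicity so has
      \<open>x i\<close>.\<close>
    show "\<exists>y\<ge>0. norm y \<le> 1 \<and> e / 2 \<le> dual_apply (x i) y" if i: "i \<in> J" for i
    proof (rule dual_pos_norm_witness)
      obtain j where j: "j \<in> I" "le i j" "e \<le> norm (x j)"
        using far i unfolding J_def by blast
      then have "norm (x j) \<le> norm (x i)"
        using i by (intro norm_mono_nonneg x0 mono) (auto simp: J_def)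
      then show "e \<le> norm (x i)" using j by simp
    qed (use i x0 e in \<open>auto simp: J_def\<close>)
    show "\<exists>j\<in>J. True \<and> dual_apply (x j) s < d" if s: "0 \<le> s" and d: "0 < d" for s :: 'a and d :: real
    proof -
      obtain j where j: "j \<in> I" "dual_apply (x j) s < d"
        using net_decreases_to_zero_dual[OF dir dec s d] by blast
      obtain k where k: "k \<in> I" "le i0 k" "le j k"
        using dir i0 j unfolding directed_index_def by blast
      then have "dual_apply (x k) s \<le> dual_apply (x j) s"
        using j s by (intro dual_le mono)
      then show ?thesis
        using k j mono[OF i0 k(1,2)] by (intro bexI[of _ k]) (auto simp: J_def)
    qed
  qed
  then obtain r :: "nat \<Rightarrow> 'a dual_space" and u :: "nat \<Rightarrow> 'a"
    where r: "\<And>n. r n \<in> J" and u: "\<And>n. 0 \<le> u n" "\<And>n. norm (u n) \<le> 1"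
      "\<And>n. e / 2 / 2 \<le> dual_apply (x (r n)) (u n)"
      "\<And>m n. m \<noteq> n \<Longrightarrow> inf (u m) (u n) = 0"
    by blast
  have "e / 4 \<le> dual_apply (x i0) (u n)" for n
    using u(3)[of n] dual_le[OF _ u(1), of "x (r n)" "x i0" n] r[of n] by (simp add: J_def)
  then show ?thesis
    using e u x0[OF i0] by (intro exI[of _ "x i0"] exI[of _ u] exI[of _ "e / 4"]) auto
qed

section \<open>Weak compactness\<close>

lemma topspace_weak_topology [simp]: "topspace weak_topology = (UNIV :: 'a::real_normed_vector set)"
proof -
  have "dual_apply 0 -` UNIV \<in> {dual_apply \<phi> -` U |\<phi> (U :: real set). open U}" by blast
  then show ?thesis unfolding weak_topology_def topology_generated_by_topspace by auto
qed

lemma openin_weak_ball: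
  fixes x :: "'a::real_normed_vector"
  shows "openin weak_topology {y. \<bar>dual_apply \<phi> (y - x)\<bar> < d}"
proof -
  have "{y. \<bar>dual_apply \<phi> (y - x)\<bar> < d} = dual_apply \<phi> -` ball (dual_apply \<phi> x) d"
    by (auto simp: dist_real_def abs_minus_commute)
  moreover have "openin weak_topology (dual_apply \<phi> -` ball (dual_apply \<phi> x) d)"
    unfolding weak_topology_def by (rule topology_generated_by_Basis) blast
  ultimately show ?thesis by simp
qed

lemma openin_weak_basis:
  fixes x :: "'a::real_normed_vector"
  assumes "finite \<Phi>"
  shows "openin weak_topology {y. \<forall>\<phi>\<in>\<Phi>. \<bar>dual_apply \<phi> (y - x)\<bar> < d}"
proof -
  have eq: "{y. \<forall>\<phi>\<in>\<Phi>. \<bar>dual_apply \<phi> (y - x)\<bar> < d} =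
      (\<Inter>\<phi>\<in>\<Phi>. {y. \<bar>dual_apply \<phi> (y - x)\<bar> < d}) \<inter> topspace weak_topology"
    by auto
  show ?thesis
    unfolding eq by (rule openin_INT[OF assms openin_weak_ball])
qed

text \<open>Induction on the generation of the topology: an intersection takes the union of the two
  finite sets of functionals and the smaller radius.\<close>

lemma openin_weakD:
  fixes x :: "'a::real_normed_vector"
  assumes "openin weak_topology U" "x \<in> U"
  shows "\<exists>\<Phi> d. finite \<Phi> \<and> 0 < d \<and> {y. \<forall>\<phi>\<in>\<Phi>. \<bar>dual_apply \<phi> (y - x)\<bar> < d} \<subseteq> U"
proof -
  have "generate_topology_on {dual_apply \<phi> -` U |\<phi> (U :: real set). open U} U"
    using assms(1) unfolding weak_topology_def by (rule openin_topology_generated_by)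
  then show ?thesis using assms(2)
  proof (induction rule: generate_topology_on.induct)
    case (Int a b)
    have "x \<in> a" "x \<in> b" using Int.prems by auto
    from Int.IH(1)[OF \<open>x \<in> a\<close>] obtain \<Phi> d where a: "finite \<Phi>" "0 < d"
      "{y. \<forall>\<phi>\<in>\<Phi>. \<bar>dual_apply \<phi> (y - x)\<bar> < d} \<subseteq> a"
      by (elim exE conjE) (rule that)
    from Int.IH(2)[OF \<open>x \<in> b\<close>] obtain \<Psi> e where b: "finite \<Psi>" "0 < e"
      "{y. \<forall>\<phi>\<in>\<Psi>. \<bar>dual_apply \<phi> (y - x)\<bar> < e} \<subseteq> b"
      by (elim exE conjE) (rule that)
    have "{y. \<forall>\<phi>\<in>\<Phi> \<union> \<Psi>. \<bar>dual_apply \<phi> (y - x)\<bar> < min d e} \<subseteq> a \<inter> b"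
      using a(3) b(3) by (intro subsetI) (simp only: subset_eq mem_Collect_eq ball_Un min_less_iff_conj Int_iff, blast)
    with a(1,2) b(1,2) show ?case
      by (intro exI[of _ "\<Phi> \<union> \<Psi>"] exI[of _ "min d e"] conjI) simp_all
  next
    case (UN K)
    obtain k where k: "k \<in> K" "x \<in> k" using UN.prems by blast
    from UN.IH[OF k] obtain \<Phi> d where a: "finite \<Phi>" "0 < d"
      "{y. \<forall>\<phi>\<in>\<Phi>. \<bar>dual_apply \<phi> (y - x)\<bar> < d} \<subseteq> k"
      by (elim exE conjE) (rule that)
    have "{y. \<forall>\<phi>\<in>\<Phi>. \<bar>dual_apply \<phi> (y - x)\<bar> < d} \<subseteq> \<Union> K"
      using a(3) Union_upper[OF k(1)] by (rule order_trans)
    with a(1,2) show ?case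
      by (intro exI[of _ \<Phi>] exI[of _ d] conjI)
  next
    case (Basis s)
    obtain \<phi> and V :: "real set" where V: "s = dual_apply \<phi> -` V" "open V"
      using Basis.hyps by blast
    have "dual_apply \<phi> x \<in> V" using Basis.prems V(1) by simp
    then obtain d where d: "0 < d" "ball (dual_apply \<phi> x) d \<subseteq> V"
      by (rule openE[OF V(2)]) (rule that)
    have "{y. \<forall>\<phi>\<in>{\<phi>}. \<bar>dual_apply \<phi> (y - x)\<bar> < d} \<subseteq> s"
      unfolding V(1) using d(2) by (auto simp: dist_real_def subset_eq abs_minus_commute)
    with d(1) show ?case
      by (intro exI[of _ "{\<phi>}"] exI[of _ d] conjI) simp_all
  qed simp
qed

text \<open>Otherwise every point has a weakly open neighbourhood that the sequence finally leaves.
  Finitely many of these cover the closure of \<open>A\<close>, and a late term lies in none of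
  them.\<close>

lemma relatively_weakly_compact_cluster:
  fixes z :: "nat \<Rightarrow> 'a::real_normed_vector"
  assumes A: "relatively_weakly_compact A" and z: "\<And>k. z k \<in> A"
  shows "\<exists>x. \<forall>\<Phi> d N. finite \<Phi> \<longrightarrow> 0 < d \<longrightarrow> (\<exists>k\<ge>N. \<forall>\<phi>\<in>\<Phi>. \<bar>dual_apply \<phi> (z k - x)\<bar> < d)"
proof (rule ccontr)
  assume neg: "\<not> ?thesis"
  define \<U> where "\<U> = {V. openin weak_topology V \<and> (\<forall>\<^sub>F k in sequentially. z k \<notin> V)}"
  have K: "compactin weak_topology (weak_topology closure_of A)"
    using A by (simp add: relatively_weakly_compact_def)
  have "x \<in> \<Union> \<U>" for x
  proof -
    from neg obtain \<Phi> d N where *: "finite \<Phi>" "0 < d"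
      "\<not> (\<exists>k\<ge>N. \<forall>\<phi>\<in>\<Phi>. \<bar>dual_apply \<phi> (z k - x)\<bar> < d)"
      by blast
    define V where "V = {y. \<forall>\<phi>\<in>\<Phi>. \<bar>dual_apply \<phi> (y - x)\<bar> < d}"
    have "\<forall>k\<ge>N. z k \<notin> V" using *(3) by (simp add: V_def)
    then have "V \<in> \<U>"
      using openin_weak_basis[OF *(1), of x d] by (auto simp: \<U>_def V_def eventually_sequentially)
    moreover have "x \<in> V" using *(2) by (simp add: V_def)
    ultimately show ?thesis by blast
  qed
  then have "weak_topology closure_of A \<subseteq> \<Union> \<U>" by blast
  moreover have "\<forall>V\<in>\<U>. openin weak_topology V" by (simp add: \<U>_def)
  ultimately obtain \<F> where \<F>: "finite \<F>" "\<F> \<subseteq> \<U>" "weak_topology closure_of A \<subseteq> \<Union> \<F>"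
    using K unfolding compactin_def by meson
  have "\<forall>\<^sub>F k in sequentially. \<forall>V\<in>\<F>. z k \<notin> V"
    using \<F>(1,2) by (intro eventually_ball_finite) (auto simp: \<U>_def)
  then obtain k where "\<forall>V\<in>\<F>. z k \<notin> V"
    by (auto simp: eventually_sequentially)
  moreover have "z k \<in> weak_topology closure_of A"
    using closure_of_subset[of A weak_topology] z by auto
  ultimately show False using \<F>(3) by blast
qed

text \<open>A cover member around 0 contains a tail of \<open>v\<close>, and finitely many more
  members contain the remaining terms. These sets also cover the closure: a point outside all of
  them has a weak neighbourhood that misses the whole range.\<close>

lemma relatively_weakly_compact_range:
  fixes v :: "nat \<Rightarrow> 'a::real_normed_vector"
  assumes v: "weakly_null v"
  shows "relatively_weakly_compact (range v)"
  unfolding relatively_weakly_compact_def compactin_def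
proof (intro conjI allI impI)
  show "weak_topology closure_of range v \<subseteq> topspace weak_topology"
    by (rule closure_of_subset_topspace)
  have small: "\<exists>N. \<forall>n\<ge>N. \<forall>\<phi>\<in>\<Phi>. \<bar>dual_apply \<phi> (v n)\<bar> < d" if "finite \<Phi>" "0 < d" for \<Phi> d
  proof -
    have "\<forall>\<phi>\<in>\<Phi>. \<forall>\<^sub>F n in sequentially. \<bar>dual_apply \<phi> (v n)\<bar> < d"
      using v that unfolding weakly_null_def by (auto simp: tendsto_iff)
    then have "\<forall>\<^sub>F n in sequentially. \<forall>\<phi>\<in>\<Phi>. \<bar>dual_apply \<phi> (v n)\<bar> < d"
      using that by (simp add: eventually_ball_finite)
    then show ?thesis by (simp add: eventually_sequentially)
  qed
  fix \<U> :: "'a set set"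
  assume \<U>: "(\<forall>U\<in>\<U>. openin weak_topology U) \<and> weak_topology closure_of range v \<subseteq> \<Union> \<U>"
  have "0 \<in> weak_topology closure_of range v"
    unfolding in_closure_of
  proof (intro conjI allI impI)
    fix T :: "'a set" assume T: "0 \<in> T \<and> openin weak_topology T"
    from openin_weakD[OF conjunct2[OF T] conjunct1[OF T]]
    obtain \<Phi> d where \<Phi>: "finite \<Phi>" "0 < d" "{y. \<forall>\<phi>\<in>\<Phi>. \<bar>dual_apply \<phi> (y - 0)\<bar> < d} \<subseteq> T"
      by (elim exE conjE) (rule that)
    from small[OF \<Phi>(1,2)] obtain N where "\<forall>\<phi>\<in>\<Phi>. \<bar>dual_apply \<phi> (v N)\<bar> < d" by blast
    then have "v N \<in> T" by (intro subsetD[OF \<Phi>(3)]) simp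
    then show "\<exists>y. y \<in> range v \<and> y \<in> T" by blast
  qed simp
  then obtain U0 where U0: "U0 \<in> \<U>" "0 \<in> U0" using \<U> by blast
  have op: "openin weak_topology U" if "U \<in> \<U>" for U using \<U> that by blast
  from openin_weakD[OF op U0(2), OF U0(1)]
  obtain \<Phi> d where \<Phi>: "finite \<Phi>" "0 < d" "{y. \<forall>\<phi>\<in>\<Phi>. \<bar>dual_apply \<phi> (y - 0)\<bar> < d} \<subseteq> U0"
    by (elim exE conjE) (rule that)
  \<comment> \<open>At a point outside \<open>U0\<close> some functional of \<Phi> has size at least
    \<open>d\<close>, so its ball of radius \<open>d / 2\<close> misses all \<open>v n\<close> with
    \<open>n \<ge> N\<close>.\<close>
  obtain N where N: "\<And>n \<phi>. N \<le> n \<Longrightarrow> \<phi> \<in> \<Phi> \<Longrightarrow> \<bar>dual_apply \<phi> (v n)\<bar> < d / 2"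
    using small[of \<Phi> "d / 2"] \<Phi> by auto
  have "v n \<in> weak_topology closure_of range v" for n
    using closure_of_subset[of "range v" weak_topology] by auto
  then have "\<exists>U\<in>\<U>. v n \<in> U" for n using \<U> by blast
  then obtain W where W: "\<And>n. W n \<in> \<U>" "\<And>n. v n \<in> W n" by metis
  have "weak_topology closure_of range v \<subseteq> \<Union> (insert U0 (W ` {..<N}))"
  proof (rule subsetI, rule ccontr)
    fix z assume z: "z \<in> weak_topology closure_of range v" "z \<notin> \<Union> (insert U0 (W ` {..<N}))"
    \<comment> \<open>The separating functional exists because \<open>z\<close> lies outside a
      weakly open set around \<open>v n\<close>.\<close>
    have "\<exists>\<phi>. dual_apply \<phi> (z - v n) \<noteq> 0" if "n < N" for n
    proof -
      from openin_weakD[OF op[OF W(1)] W(2), of n]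
      obtain \<Psi> e where "0 < e" "{y. \<forall>\<phi>\<in>\<Psi>. \<bar>dual_apply \<phi> (y - v n)\<bar> < e} \<subseteq> W n"
        by (elim exE conjE) (rule that)
      moreover have "z \<notin> W n" using z that by blast
      ultimately have "z \<notin> {y. \<forall>\<phi>\<in>\<Psi>. \<bar>dual_apply \<phi> (y - v n)\<bar> < e}" by blast
      then obtain \<phi> where "\<not> \<bar>dual_apply \<phi> (z - v n)\<bar> < e" by blast
      then show ?thesis using \<open>0 < e\<close> by (intro exI[of _ \<phi>]) linarith
    qed
    then obtain q where q: "\<And>n. n < N \<Longrightarrow> dual_apply (q n) (z - v n) \<noteq> 0" by metis
    have "z \<notin> U0" using z(2) by blast
    then have "z \<notin> {y. \<forall>\<phi>\<in>\<Phi>. \<bar>dual_apply \<phi> (y - 0)\<bar> < d}" using \<Phi>(3) by blast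
    then obtain \<phi> where \<phi>: "\<phi> \<in> \<Phi>" "d \<le> \<bar>dual_apply \<phi> z\<bar>"
      by (auto simp: not_less)
    define V where "V n = {y. \<bar>dual_apply (q n) (y - z)\<bar> < \<bar>dual_apply (q n) (z - v n)\<bar>}" for n
    let ?V = "((\<Inter>n\<in>{..<N}. V n) \<inter> topspace weak_topology) \<inter> {y. \<bar>dual_apply \<phi> (y - z)\<bar> < d / 2}"
    have "openin weak_topology (V n)" for n
      unfolding V_def by (rule openin_weak_ball)
    then have "openin weak_topology ?V"
      by (intro openin_Int[OF openin_INT openin_weak_ball]) simp_all
    moreover have "z \<in> ?V" using q \<Phi>(2) by (simp add: V_def)
    ultimately have "\<exists>y. y \<in> range v \<and> y \<in> ?V"
      using z(1)[unfolded in_closure_of, THEN conjunct2, THEN spec, of ?V] by blast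
    then obtain k where k: "v k \<in> ?V" by (elim exE conjE rangeE) (rule that, simp only:)
    show False
    proof (cases "k < N")
      case True
      then have "v k \<in> V k" using k by (simp only: Int_iff INT_iff lessThan_iff)
      moreover have "\<bar>dual_apply (q k) (v k - z)\<bar> = \<bar>dual_apply (q k) (z - v k)\<bar>"
        by simp
      ultimately show False by (simp add: V_def)
    next
      case False
      then have "\<bar>dual_apply \<phi> (v k)\<bar> < d / 2" using N \<phi>(1) by simp
      moreover have "\<bar>dual_apply \<phi> (v k) - dual_apply \<phi> z\<bar> < d / 2" using k by simp
      ultimately show False using \<phi>(2) by linarith
    qed
  qed
  then show "\<exists>\<F>. finite \<F> \<and> \<F> \<subseteq> \<U> \<and> weak_topology closure_of range v \<subseteq> \<Union> \<F>"
    using U0(1) W(1) by (intro exI[of _ "insert U0 (W ` {..<N})"]) auto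
qed

section \<open>Sufficiency\<close>

lemma disjoint_seq_scaleR:
  assumes f: "disjoint_seq f" and c: "\<And>n. \<bar>c n\<bar> \<le> 1"
  shows "disjoint_seq (\<lambda>n. c n *\<^sub>R f n)"
  unfolding disjoint_seq_def
proof (intro allI impI)
  have le: "\<bar>c n *\<^sub>R f n\<bar> \<le> \<bar>f n\<bar>" for n
  proof -
    have abs1: "\<bar>t *\<^sub>R x\<bar> \<le> \<bar>x\<bar>" if "0 \<le> t" "t \<le> 1" for t :: real and x :: 'a
    proof -
      have "t *\<^sub>R x \<le> t *\<^sub>R \<bar>x\<bar>" "t *\<^sub>R (- x) \<le> t *\<^sub>R \<bar>x\<bar>"
        by (rule scaleR_left_mono[OF abs_ge_self that(1)])
          (rule scaleR_left_mono[OF abs_ge_minus_self that(1)])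
      moreover have "t *\<^sub>R \<bar>x\<bar> \<le> 1 *\<^sub>R \<bar>x\<bar>"
        using that by (intro scaleR_right_mono) auto
      ultimately have "t *\<^sub>R x \<le> \<bar>x\<bar>" "- (t *\<^sub>R x) \<le> \<bar>x\<bar>"
        by (auto simp only: scaleR_one scaleR_minus_right intro: order_trans)
      then show ?thesis by (simp add: abs_lattice)
    qed
    show ?thesis
    proof (cases "0 \<le> c n")
      case True
      then show ?thesis using abs1[of "c n" "f n"] c[of n] by simp
    next
      case False
      then show ?thesis using abs1[of "- c n" "f n"] c[of n] by simp
    qed
  qed
  fix m n :: nat assume "m \<noteq> n"
  then have "inf \<bar>f m\<bar> \<bar>f n\<bar> = 0" using f by (simp add: disjoint_seq_def)
  then show "inf \<bar>c m *\<^sub>R f m\<bar> \<bar>c n *\<^sub>R f n\<bar> = 0"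
    by (rule disjoint_mono) (use le in auto)
qed

lemma tendsto_zero_parts:
  fixes f :: "nat \<Rightarrow> 'a::banach_lattice"
  assumes "(\<lambda>n. pprt (f n)) \<longlonglongrightarrow> 0" "(\<lambda>n. pprt (- f n)) \<longlonglongrightarrow> 0"
  shows "f \<longlonglongrightarrow> 0"
  using tendsto_diff[OF assms] by (simp add: pprt_neg flip: prts)

lemma almost_weakly_limitedI:
  fixes T :: "'e::banach_lattice \<Rightarrow>\<^sub>L 'f::banach_lattice"
  assumes "\<And>f. disjoint_seq f \<Longrightarrow> weakly_null f \<Longrightarrow>
    \<exists>b. b \<longlonglongrightarrow> 0 \<and> (\<forall>n x. norm x \<le> 1 \<longrightarrow> \<bar>dual_apply (f n) (blinfun_apply T x)\<bar> \<le> b n)"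
  shows "almost_weakly_limited T"
  unfolding almost_weakly_limited_def almost_DP_set_def
proof (intro allI impI)
  fix f :: "nat \<Rightarrow> 'f dual_space" assume "disjoint_seq f" "weakly_null f"
  then obtain b where b: "b \<longlonglongrightarrow> 0"
      "\<And>n x. norm x \<le> 1 \<Longrightarrow> \<bar>dual_apply (f n) (blinfun_apply T x)\<bar> \<le> b n"
    using assms by blast
  show "uniform_limit (blinfun_apply T ` cball 0 1) (\<lambda>n. dual_apply (f n)) (\<lambda>_. 0) sequentially"
  proof (rule uniform_limitI)
    fix e :: real assume "0 < e"
    then have "\<forall>\<^sub>F n in sequentially. b n < e"
      using b(1) by (rule order_tendstoD(2)[rotated])
    then show "\<forall>\<^sub>F n in sequentially. \<forall>y\<in>blinfun_apply T ` cball 0 1. dist (dual_apply (f n) y) 0 < e"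
      by eventually_elim (auto intro: le_less_trans[OF b(2)])
  qed
qed

text \<open>The positive parts of \<open>f n\<close> and \<open>- f n\<close> are weakly null by
  \<open>weakly_null_pprt\<close>, hence norm null, and so is \<open>f\<close>.\<close>

lemma positive_schur_imp_almost_weakly_limited:
  fixes T :: "'e::banach_lattice \<Rightarrow>\<^sub>L 'f::banach_lattice"
  assumes schur: "positive_schur TYPE('f dual_space)"
  shows "almost_weakly_limited T"
proof (rule almost_weakly_limitedI)
  fix f :: "nat \<Rightarrow> 'f dual_space" assume f: "disjoint_seq f" "weakly_null f"
  have pos: "(\<lambda>n. pprt (g n)) \<longlonglongrightarrow> 0" if "disjoint_seq g" "weakly_null g" for g :: "nat \<Rightarrow> 'f dual_space"
    using schur[unfolded positive_schur_def, THEN spec, of "\<lambda>n. pprt (g n)"] weakly_null_pprt[OF that]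
    by simp
  have "f \<longlonglongrightarrow> 0"
    using disjoint_seq_scaleR[OF f(1), of "\<lambda>_. - 1"] weakly_null_uminus[OF f(2)]
    by (intro tendsto_zero_parts[of f] pos[OF f] pos[of "\<lambda>n. - f n"]) simp_all
  then have "(\<lambda>n. norm (f n) * norm T) \<longlonglongrightarrow> 0"
    by (intro tendsto_mult_left_zero tendsto_norm_zero)
  moreover have "\<bar>dual_apply (f n) (blinfun_apply T x)\<bar> \<le> norm (f n) * norm T" if "norm x \<le> 1" for n x
  proof -
    have "norm (blinfun_apply T x) \<le> norm T * norm x" by (rule norm_blinfun)
    also have "\<dots> \<le> norm T" using that by (simp add: mult_left_le)
    finally have "norm (f n) * norm (blinfun_apply T x) \<le> norm (f n) * norm T"
      by (simp add: mult_left_mono)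
    then show ?thesis using norm_dual_apply[of "f n" "blinfun_apply T x"] by simp
  qed
  ultimately show "\<exists>b. b \<longlonglongrightarrow> 0 \<and>
      (\<forall>n x. norm x \<le> 1 \<longrightarrow> \<bar>dual_apply (f n) (blinfun_apply T x)\<bar> \<le> b n)"
    by blast
qed

section \<open>The adjoint and the case of an order continuous dual norm\<close>

definition dual_adjoint :: "('e::real_normed_vector \<Rightarrow>\<^sub>L 'f::real_normed_vector) \<Rightarrow> 'f dual_space \<Rightarrow> 'e dual_space"
  where "dual_adjoint T f = Dual (\<lambda>x. dual_apply f (blinfun_apply T x))"

lemma dual_adjoint_apply: "dual_apply (dual_adjoint T f) x = dual_apply f (blinfun_apply T x)"
proof -
  have "bounded_linear (\<lambda>x. dual_apply f (blinfun_apply T x))"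
    by (intro bounded_linear_compose[OF bounded_linear_dual_apply] blinfun.bounded_linear_right)
  then show ?thesis by (simp add: dual_adjoint_def Dual_inverse)
qed

lemma dual_adjoint_scaleR: "dual_adjoint T (c *\<^sub>R f) = c *\<^sub>R dual_adjoint T f"
  by (rule dual_eqI) (simp add: dual_adjoint_apply)

lemma dual_adjoint_uminus: "dual_adjoint T (- f) = - dual_adjoint T f"
  by (rule dual_eqI) (simp add: dual_adjoint_apply)

lemma norm_pprt_le: "norm (pprt x) \<le> norm (x :: 'a::banach_lattice)"
proof -
  have "pprt x \<le> \<bar>x\<bar>" by (simp add: abs_prts)
  then have "norm (pprt x) \<le> norm \<bar>x\<bar>" by (intro norm_mono_nonneg) auto
  then show ?thesis by simp
qed

lemma not_tendsto_zeroD: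
  fixes f :: "nat \<Rightarrow> 'a::real_normed_vector"
  assumes "\<not> f \<longlonglongrightarrow> 0"
  shows "\<exists>e>0. \<forall>N. \<exists>n\<ge>N. e \<le> norm (f n)"
proof -
  have "\<not> (\<forall>e>0. \<exists>N. \<forall>n\<ge>N. norm (f n) < e)"
    using assms by (simp add: LIMSEQ_iff)
  then show ?thesis by (simp add: not_less)
qed

text \<open>The order hypothesis makes the positive parts pointwise null on the cone, so a failure
  would feed the gliding hump. The disjoint vectors it yields are replaced by smaller ones on which
  \<open>f (r n)\<close> after \<open>T\<close> is large. These are weakly null by order continuity,
  contradicting the weak hypothesis.\<close>

lemma order_continuous_pprt_dual_adjoint:
  fixes T :: "'e::banach_lattice \<Rightarrow>\<^sub>L 'f::banach_lattice"
  assumes oc: "order_continuous_norm TYPE('e dual_space)"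
    and T: "order_almost_DP T" "weak_and_almost_DP T"
    and f: "disjoint_seq f" "weakly_null f" and le1: "\<And>n. norm (dual_adjoint T (f n)) \<le> 1"
  shows "(\<lambda>n. pprt (dual_adjoint T (f n))) \<longlonglongrightarrow> 0"
proof (rule ccontr)
  let ?g = "\<lambda>n. pprt (dual_adjoint T (f n))"
  assume "\<not> ?g \<longlonglongrightarrow> 0"
  then obtain e where e: "0 < e" and far: "\<And>N. \<exists>n\<ge>N. e \<le> norm (?g n)"
    using not_tendsto_zeroD by blast
  \<comment> \<open>The Riesz--Kantorovich formula: the positive part at \<open>x\<close> is the
    supremum of the functional over \<open>{0..x}\<close>.\<close>
  have sup_apply: "\<exists>y. 0 \<le> y \<and> y \<le> x \<and> b < dual_apply (f n) (blinfun_apply T y)"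
    if "0 \<le> x" "b < dual_apply (?g n) x" for x b n
  proof (rule ccontr)
    assume "\<not> ?thesis"
    then have "rk_cone (dual_apply (dual_adjoint T (f n))) x \<le> b"
      using that by (intro rk_least) (auto simp: dual_adjoint_apply not_less)
    then show False
      using that by (simp add: dual_pos_cone flip: dual_pos_eq_pprt)
  qed
  define I where "I = {n. e \<le> norm (?g n)}"
  have "\<exists>(r :: nat \<Rightarrow> nat) u. (\<forall>n. r n \<in> I \<and> r n < r (Suc n) \<and> 0 \<le> u n \<and> norm (u n) \<le> 1 \<and>
      e / 2 / 2 \<le> dual_apply (?g (r n)) (u n)) \<and> (\<forall>m n. m \<noteq> n \<longrightarrow> inf (u m) (u n) = 0)"
  proof (rule gliding_hump_disjoint[where R = "(<)"])
    show "I \<noteq> {}" using far[of 0] by (auto simp: I_def)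
    show "0 < e / 2" using e by simp
    show "0 \<le> ?g i" for i by simp
    show "norm (?g i) \<le> 1" for i
      using norm_pprt_le le1 by (rule order_trans)
    show "\<exists>x\<ge>0. norm x \<le> 1 \<and> e / 2 \<le> dual_apply (?g i) x" if "i \<in> I" for i
      using that e by (intro dual_pos_norm_witness) (auto simp: I_def)
    show "\<exists>j\<in>I. i < j \<and> dual_apply (?g j) s < d" if s: "0 \<le> s" and d: "0 < d" for i s d
    proof -
      have "order_bounded {0..s}" by (auto simp: order_bounded_def)
      then have "uniform_limit (blinfun_apply T ` {0..s}) (\<lambda>n. dual_apply (f n)) (\<lambda>_. 0) sequentially"
        using T(1) f unfolding order_almost_DP_def almost_DP_set_def by blast
      then have "\<forall>\<^sub>F n in sequentially. \<forall>y\<in>blinfun_apply T ` {0..s}. dist (dual_apply (f n) y) 0 < d / 2"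
        using d by (intro uniform_limitD) auto
      then obtain N where "\<forall>n\<ge>N. \<forall>y\<in>blinfun_apply T ` {0..s}. dist (dual_apply (f n) y) 0 < d / 2"
        unfolding eventually_sequentially by blast
      then have N: "\<bar>dual_apply (f n) (blinfun_apply T y)\<bar> < d / 2" if "N \<le> n" "0 \<le> y" "y \<le> s" for n y
        using that by simp
      obtain j where j: "max N (Suc i) \<le> j" "e \<le> norm (?g j)" using far by blast
      have "dual_apply (?g j) s \<le> d / 2"
      proof (rule ccontr)
        assume "\<not> ?thesis"
        then obtain y where "0 \<le> y" "y \<le> s" "d / 2 < dual_apply (f j) (blinfun_apply T y)"
          using sup_apply[OF s, of "d / 2" j] by auto
        then show False using N[of j y] j(1) by simp
      qed
      then show ?thesis using j d by (intro bexI[of _ j]) (auto simp: I_def)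
    qed
  qed
  then obtain r :: "nat \<Rightarrow> nat" and u :: "nat \<Rightarrow> 'e" where r: "\<And>n. r n < r (Suc n)"
    and u: "\<And>n. 0 \<le> u n" "\<And>n. norm (u n) \<le> 1" "\<And>n. e / 2 / 2 \<le> dual_apply (?g (r n)) (u n)"
      "\<And>m n. m \<noteq> n \<Longrightarrow> inf (u m) (u n) = 0"
    by blast
  \<comment> \<open>A strict inequality below \<open>e / 4\<close> is what the supremum formula
    needs.\<close>
  have "e / 8 < dual_apply (?g (r n)) (u n)" for n using u(3)[of n] e by simp
  then have "\<forall>n. \<exists>y. 0 \<le> y \<and> y \<le> u n \<and> e / 8 < dual_apply (f (r n)) (blinfun_apply T y)"
    using sup_apply[OF u(1)] by blast
  then obtain v where v: "\<And>n. 0 \<le> v n" "\<And>n. v n \<le> u n"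
      "\<And>n. e / 8 < dual_apply (f (r n)) (blinfun_apply T (v n))"
    by metis
  have "weakly_null v"
  proof (rule order_continuous_dual_imp_weakly_null[OF oc v(1)])
    show "norm (v n) \<le> 1" for n
      using norm_mono_nonneg[OF v(1,2)] u(2) by (rule order_trans)
    show "inf (v m) (v n) = 0" if "m \<noteq> n" for m n
      by (rule disjoint_mono[OF u(4)[OF that] v(1,2) v(1,2)])
  qed
  then have "uniform_limit (blinfun_apply T ` range v) (\<lambda>n. dual_apply (f n)) (\<lambda>_. 0) sequentially"
    using T(2) f relatively_weakly_compact_range unfolding weak_and_almost_DP_def almost_DP_set_def
    by blast
  then have "\<forall>\<^sub>F n in sequentially. \<forall>y\<in>blinfun_apply T ` range v. dist (dual_apply (f n) y) 0 < e / 8"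
    using e by (intro uniform_limitD) auto
  then obtain N where "\<forall>n\<ge>N. \<forall>y\<in>blinfun_apply T ` range v. dist (dual_apply (f n) y) 0 < e / 8"
    unfolding eventually_sequentially by blast
  then have "\<bar>dual_apply (f n) (blinfun_apply T (v k))\<bar> < e / 8" if "N \<le> n" for n k
    using that by simp
  \<comment> \<open>The estimate is uniform in \<open>k\<close>, so it may be read on the diagonal
    at \<open>n = r N\<close> and \<open>k = N\<close>.\<close>
  moreover have "N \<le> r N"
    using r by (intro strict_mono_imp_increasing) (simp add: strict_mono_Suc_iff)
  ultimately have "\<bar>dual_apply (f (r N)) (blinfun_apply T (v N))\<bar> < e / 8" by blast
  then show False using v(3)[of N] by simp
qed

lemma order_continuous_imp_almost_weakly_limited:
  fixes T :: "'e::banach_lattice \<Rightarrow>\<^sub>L 'f::banach_lattice"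
  assumes oc: "order_continuous_norm TYPE('e dual_space)"
    and T: "order_almost_DP T" "weak_and_almost_DP T"
  shows "almost_weakly_limited T"
proof (rule almost_weakly_limitedI)
  fix f :: "nat \<Rightarrow> 'f dual_space" assume f: "disjoint_seq f" "weakly_null f"
  define a where "a n = norm (dual_adjoint T (f n))" for n
  \<comment> \<open>Scaling brings the adjoint norms below 1 while leaving terms with
    \<open>a n \<le> 1\<close> unchanged.\<close>
  define c where "c n = inverse (max 1 (a n))" for n
  define h where "h n = c n *\<^sub>R f n" for n
  have c: "0 < c n" "c n \<le> 1" "\<bar>c n\<bar> \<le> 1" for n
    by (auto simp: c_def intro!: inverse_le_1_iff[THEN iffD2])
  have h: "disjoint_seq h" "weakly_null h"
    unfolding h_def by (intro disjoint_seq_scaleR weakly_null_scaleR f c)+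
  have a0: "0 \<le> a n" for n by (simp add: a_def)
  have norm_h: "norm (dual_adjoint T (h n)) = c n * a n" for n
    using c(1)[of n] by (simp add: h_def dual_adjoint_scaleR a_def)
  have ca: "c n * a n \<le> 1" for n
    using a0[of n] by (simp add: c_def field_simps)
  have "(\<lambda>n. pprt (dual_adjoint T (h n))) \<longlonglongrightarrow> 0"
    by (rule order_continuous_pprt_dual_adjoint[OF oc T h]) (simp add: norm_h ca)
  moreover have "(\<lambda>n. pprt (- dual_adjoint T (h n))) \<longlonglongrightarrow> 0"
    unfolding dual_adjoint_uminus[symmetric]
    using disjoint_seq_scaleR[OF h(1), of "\<lambda>_. - 1"] weakly_null_uminus[OF h(2)]
    by (intro order_continuous_pprt_dual_adjoint[OF oc T]) (simp_all add: norm_h ca dual_adjoint_uminus)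
  ultimately have "(\<lambda>n. dual_adjoint T (h n)) \<longlonglongrightarrow> 0" by (rule tendsto_zero_parts)
  then have lim: "(\<lambda>n. c n * a n) \<longlonglongrightarrow> 0"
    using tendsto_norm_zero by (fastforce simp: norm_h)
  then have "\<forall>\<^sub>F n in sequentially. c n * a n < 1"
    by (rule order_tendstoD) simp
  \<comment> \<open>If \<open>a n > 1\<close> then \<open>c n * a n = 1\<close>. So once the product
    is below 1, no scaling has taken place.\<close>
  then have "\<forall>\<^sub>F n in sequentially. c n * a n = a n"
  proof eventually_elim
    case (elim n)
    then have "a n \<le> 1" by (cases "a n \<le> 1") (auto simp: c_def max_def)
    then show ?case by (simp add: c_def max_def)
  qed
  then have "a \<longlonglongrightarrow> 0"
    using lim by (rule Lim_transform_eventually[rotated])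
  moreover have "\<bar>dual_apply (f n) (blinfun_apply T x)\<bar> \<le> a n" if "norm x \<le> 1" for n x
    using dual_le_norm[OF that, of "dual_adjoint T (f n)"] by (simp add: dual_adjoint_apply a_def)
  ultimately show "\<exists>b. b \<longlonglongrightarrow> 0 \<and>
      (\<forall>n x. norm x \<le> 1 \<longrightarrow> \<bar>dual_apply (f n) (blinfun_apply T x)\<bar> \<le> b n)"
    by blast
qed

section \<open>Necessity\<close>

text \<open>Split \<open>x\<close> into \<open>inf x (k u)\<close> and the rest. The component at
  \<open>v\<close> vanishes on the first piece, and the component at \<open>u\<close> tends to 0 on
  the second.\<close>

lemma dual_comp_inf_eq_0:
  fixes u v :: "'a::banach_lattice"
  assumes pos: "0 \<le> \<phi>" "0 \<le> \<psi>" "0 \<le> u" "0 \<le> v" and disj: "inf u v = 0"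
  shows "inf (dual_comp \<phi> u) (dual_comp \<psi> v) = 0"
proof (rule antisym)
  let ?g = "inf (dual_comp \<phi> u) (dual_comp \<psi> v)"
  show "?g \<le> 0"
    unfolding less_eq_dual_space_def
  proof (intro allI impI)
    fix x :: 'a assume x: "0 \<le> x"
    have le: "dual_apply ?g x \<le> dual_apply (dual_comp \<phi> u) x - dual_apply \<phi> (inf x (real k *\<^sub>R u))" for k
    proof -
      let ?y = "inf x (real k *\<^sub>R u)"
      have y: "0 \<le> ?y" using x pos by (simp add: scaleR_nonneg_nonneg)
      have xy: "0 \<le> x - ?y" by (simp only: diff_ge_0_iff_ge inf_le1)
      have "inf (real k *\<^sub>R u) v = 0"
        using disjoint_scaleR[OF pos(3,4) disj, of "real k" 1] by simp
      then have "inf ?y v = 0"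
        by (rule disjoint_mono) (simp_all only: y pos inf_le2 order_refl)
      then have "dual_apply (dual_comp \<psi> v) ?y = 0"
        using dual_comp_disjoint[OF pos(2,4) y] by simp
      then have "dual_apply ?g ?y \<le> 0"
        using dual_le[OF inf_le2 y, of "dual_comp \<phi> u" "dual_comp \<psi> v"] by simp
      moreover have "dual_apply ?g (x - ?y) \<le> dual_apply (dual_comp \<phi> u) (x - ?y)"
        by (rule dual_le[OF inf_le1 xy])
      moreover have "dual_apply (dual_comp \<phi> u) ?y = dual_apply \<phi> ?y"
        by (rule dual_comp_ideal[OF pos(1,3) y, of "real k"]) simp_all
      ultimately show ?thesis unfolding dual_apply_linear by linarith
    qed
    have "(\<lambda>k. dual_apply (dual_comp \<phi> u) x - dual_apply \<phi> (inf x (real k *\<^sub>R u)))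
        \<longlonglongrightarrow> dual_apply (dual_comp \<phi> u) x - dual_apply (dual_comp \<phi> u) x"
      by (intro tendsto_diff tendsto_const dual_comp_tendsto pos x)
    then have "dual_apply ?g x \<le> dual_apply (dual_comp \<phi> u) x - dual_apply (dual_comp \<phi> u) x"
      by (rule LIMSEQ_le_const) (use le in blast)
    then show "dual_apply ?g x \<le> dual_apply 0 x" by simp
  qed
qed (simp add: dual_comp_nonneg pos)

text \<open>The gliding hump gives disjoint vectors, and the components of the functionals at them
  are disjoint by \<open>dual_comp_inf_eq_0\<close>. They stay weakly null as they lie below the
  original functionals, and they keep the values at the vectors.\<close>

lemma not_positive_schur_dual:
  assumes "\<not> positive_schur TYPE('a::banach_lattice dual_space)"
  shows "\<exists>(h :: nat \<Rightarrow> 'a dual_space) u e. disjoint_seq h \<and> weakly_null h \<and> 0 < e \<and>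
    (\<forall>n. norm (u n) \<le> 1 \<and> e \<le> dual_apply (h n) (u n))"
proof -
  obtain f0 :: "nat \<Rightarrow> 'a dual_space" where f0: "weakly_null f0" "\<And>n. 0 \<le> f0 n" "\<not> f0 \<longlonglongrightarrow> 0"
    using assms unfolding positive_schur_def by blast
  from not_tendsto_zeroD[OF f0(3)]
  obtain e0 where e0: "0 < e0" and far: "\<And>N. \<exists>n\<ge>N. e0 \<le> norm (f0 n)"
    by blast
  define c where "c n = inverse (max 1 (norm (f0 n)))" for n
  define f where "f n = c n *\<^sub>R f0 n" for n
  have c: "0 < c n" "\<bar>c n\<bar> \<le> 1" for n
    by (auto simp: c_def intro!: inverse_le_1_iff[THEN iffD2])
  have f: "weakly_null f"
    unfolding f_def by (rule weakly_null_scaleR[OF f0(1) c(2)])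
  have f_nonneg: "0 \<le> f n" for n
    unfolding f_def by (rule scaleR_nonneg_nonneg[OF less_imp_le[OF c(1)] f0(2)])
  have norm_f: "norm (f n) = c n * norm (f0 n)" for n using c(1)[of n] by (simp add: f_def)
  \<comment> \<open>After scaling, \<open>norm (f n)\<close> is the minimum of 1 and
    \<open>norm (f0 n)\<close>.\<close>
  define e where "e = min e0 1"
  define I where "I = {n. e \<le> norm (f n)}"
  have e: "0 < e" using e0 by (simp add: e_def)
  have far': "\<exists>j\<in>I. N \<le> j" for N
  proof -
    obtain n where n: "N \<le> n" "e0 \<le> norm (f0 n)" using far by blast
    have "e \<le> norm (f n)"
    proof (cases "norm (f0 n) \<le> 1")
      case True
      then show ?thesis using n by (simp add: norm_f c_def e_def)
    next
      case False
      moreover from False have "f0 n \<noteq> 0" by auto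
      ultimately have "norm (f n) = 1" by (simp add: norm_f c_def max_def)
      then show ?thesis by (simp add: e_def)
    qed
    then show ?thesis using n by (auto simp: I_def)
  qed
  have "\<exists>(r :: nat \<Rightarrow> nat) u. (\<forall>n. r n \<in> I \<and> r n < r (Suc n) \<and> 0 \<le> u n \<and> norm (u n) \<le> 1 \<and>
      e / 2 / 2 \<le> dual_apply (f (r n)) (u n)) \<and> (\<forall>m n. m \<noteq> n \<longrightarrow> inf (u m) (u n) = 0)"
  proof (rule gliding_hump_disjoint[where R = "(<)"])
    show "I \<noteq> {}" using far'[of 0] by auto
    show "0 < e / 2" using e by simp
    show "0 \<le> f i" for i by (rule f_nonneg)
    show "norm (f i) \<le> 1" for i by (simp add: norm_f c_def field_simps)
    show "\<exists>x\<ge>0. norm x \<le> 1 \<and> e / 2 \<le> dual_apply (f i) x" if "i \<in> I" for i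
      using that e by (intro dual_pos_norm_witness f_nonneg) (auto simp: I_def)
    show "\<exists>j\<in>I. i < j \<and> dual_apply (f j) s < d" if d: "0 < d" for i s d
    proof -
      obtain N where N: "\<And>n. N \<le> n \<Longrightarrow> dual_apply (f n) s < d"
        using order_tendstoD(2)[OF weakly_null_apply[OF f, of s] d]
        by (auto simp: eventually_sequentially)
      obtain j where "j \<in> I" "max N (Suc i) \<le> j" using far' by blast
      then show ?thesis using N by (intro bexI[of _ j]) auto
    qed
  qed
  then obtain r :: "nat \<Rightarrow> nat" and u :: "nat \<Rightarrow> 'a" where r: "\<And>n. r n < r (Suc n)"
    and u: "\<And>n. 0 \<le> u n" "\<And>n. norm (u n) \<le> 1" "\<And>n. e / 2 / 2 \<le> dual_apply (f (r n)) (u n)"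
      "\<And>m n. m \<noteq> n \<Longrightarrow> inf (u m) (u n) = 0"
    by blast
  define h where "h n = dual_comp (f (r n)) (u n)" for n
  have h0: "0 \<le> h n" for n by (simp add: h_def dual_comp_nonneg f_nonneg u)
  have "disjoint_seq h"
    unfolding disjoint_seq_def
  proof (intro allI impI)
    fix m n :: nat assume "m \<noteq> n"
    then have "inf (h m) (h n) = 0"
      unfolding h_def by (intro dual_comp_inf_eq_0 f_nonneg u)
    then show "inf \<bar>h m\<bar> \<bar>h n\<bar> = 0" using h0 by simp
  qed
  moreover have "weakly_null (\<lambda>n. f (r n))"
    by (rule weakly_null_subseq[OF f]) (simp add: strict_mono_Suc_iff r)
  then have "weakly_null h"
    by (rule weakly_null_mono) (simp_all add: h0 h_def dual_comp_le dual_comp_nonneg f_nonneg u)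
  moreover have "e / 4 \<le> dual_apply (h n) (u n)" for n
    using u(3)[of n] by (simp add: h_def dual_comp_self f_nonneg u)
  ultimately show ?thesis
    using u(2) e by (intro exI[of _ h] exI[of _ u] exI[of _ "e / 4"]) simp
qed

section \<open>Boundedness principles\<close>

lemma pointwise_null_imp_norm_bounded:
  fixes f :: "nat \<Rightarrow> 'a::banach dual_space"
  assumes null: "\<And>x. (\<lambda>n. dual_apply (f n) x) \<longlonglongrightarrow> 0"
  shows "\<exists>M>0. \<forall>n. norm (f n) \<le> M"
proof -
  \<comment> \<open>Uniform boundedness by Baire's theorem: these closed sets cover the space, so
    one of them contains a ball.\<close>
  define C where "C N = {x. \<forall>n. \<bar>dual_apply (f n) x\<bar> \<le> real N}" for N :: nat
  have "x \<in> \<Union> (range C)" for x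
  proof -
    obtain K where K: "\<And>n. norm (dual_apply (f n) x) \<le> K"
      using convergent_imp_Bseq[OF convergentI[OF null[of x]]] by (rule BseqE) (rule that, blast)
    obtain N where "K \<le> real N" using real_arch_simple by blast
    then have "x \<in> C N" using K by (auto simp: C_def intro: order_trans)
    then show ?thesis by blast
  qed
  then have "\<Union> (range C) = UNIV" by blast
  have closed: "closed (C N)" for N
  proof -
    have "C N = (\<Inter>n. {x. \<bar>dual_apply (f n) x\<bar> \<le> real N})" by (auto simp: C_def)
    moreover have "closed {x. \<bar>dual_apply (f n) x\<bar> \<le> real N}" for n
      by (intro closed_Collect_le continuous_on_rabs continuous_on_const
          linear_continuous_on bounded_linear_dual_apply)
    ultimately show ?thesis by auto
  qed
  have "\<exists>N. interior (C N) \<noteq> {}"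
  proof (rule ccontr)
    assume "\<not> ?thesis"
    then have "(euclidean :: 'a topology) interior_of \<Union> (range C) = {}"
      using closed by (intro Baire_category_alt) (auto simp: completely_metrizable_space_euclidean)
    then show False using \<open>\<Union> (range C) = UNIV\<close> by simp
  qed
  then obtain N a where "a \<in> interior (C N)" by blast
  then obtain r where r: "0 < r" "cball a r \<subseteq> C N"
    using open_contains_cball[of "interior (C N)"] interior_subset by (meson open_interior order_trans)
  have "norm (f n) \<le> 2 * real N / r" for n
  proof (rule norm_dual_bound)
    fix x :: 'a
    show "norm (dual_apply (f n) x) \<le> 2 * real N / r * norm x"
    proof (cases "x = 0")
      case False
      \<comment> \<open>Both \<open>a\<close> and \<open>a + t *\<^sub>R x\<close> lie in the ball
        of radius \<open>r\<close>; subtracting their values bounds the functional at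
        \<open>x\<close>.\<close>
      define t where "t = r / norm x"
      have t: "0 < t" using False r by (simp add: t_def)
      have "a + t *\<^sub>R x \<in> C N" "a \<in> C N"
        using False r by (auto simp: t_def dist_norm intro!: subsetD[OF r(2)])
      then have "\<bar>dual_apply (f n) a + t * dual_apply (f n) x\<bar> \<le> real N" "\<bar>dual_apply (f n) a\<bar> \<le> real N"
        by (auto simp: C_def)
      then have "\<bar>t * dual_apply (f n) x\<bar> \<le> 2 * real N" by linarith
      then have "\<bar>dual_apply (f n) x\<bar> \<le> 2 * real N / t"
        using t by (simp add: abs_mult field_simps)
      then show ?thesis using False by (simp add: t_def)
    qed simp
  qed (use r in simp)
  moreover have "0 \<le> 2 * real N / r" using r by simp
  ultimately have "0 < 2 * real N / r + 1 \<and> (\<forall>n. norm (f n) \<le> 2 * real N / r + 1)"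
    by (simp add: add_increasing2 add_nonneg_pos)
  then show ?thesis by (rule exI)
qed

text \<open>Near a cluster point of a sequence with \<open>\<bar>\<theta> (z k)\<bar> > k\<close>
  the values of \<theta> would stay bounded for arbitrarily large \<open>k\<close>.\<close>

lemma relatively_weakly_compact_bounded_functional:
  assumes A: "relatively_weakly_compact A"
  shows "\<exists>B. \<forall>x\<in>A. \<bar>dual_apply \<theta> x\<bar> \<le> B"
proof (rule ccontr)
  assume "\<not> ?thesis"
  then have "\<forall>k. \<exists>x. x \<in> A \<and> real k < \<bar>dual_apply \<theta> x\<bar>" by (auto simp: not_le)
  from choice[OF this] obtain z where z: "\<And>k. z k \<in> A" "\<And>k. real k < \<bar>dual_apply \<theta> (z k)\<bar>"
    by blast
  from relatively_weakly_compact_cluster[OF A, of z, OF z(1)] obtain x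
    where "\<forall>\<Phi> d N. finite \<Phi> \<longrightarrow> 0 < d \<longrightarrow> (\<exists>k\<ge>N. \<forall>\<phi>\<in>\<Phi>. \<bar>dual_apply \<phi> (z k - x)\<bar> < d)"
    by (elim exE) (rule that)
  note x = this[rule_format]
  obtain n where n: "\<bar>dual_apply \<theta> x\<bar> + 1 < real n" using reals_Archimedean2 by blast
  obtain k where k: "n \<le> k" "\<bar>dual_apply \<theta> (z k - x)\<bar> < 1"
    using x[of "{\<theta>}" 1 n] by auto
  then have "\<bar>dual_apply \<theta> (z k) - dual_apply \<theta> x\<bar> < 1" "real n \<le> real k" by simp_all
  then show False using z(2)[of k] n by linarith
qed

section \<open>Operators that factor through the space of absolutely summable sequences\<close>

context
  fixes \<psi> :: "nat \<Rightarrow> 'a::banach_lattice dual_space" and \<phi> :: "'a dual_space"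
  assumes nonneg: "\<And>m. 0 \<le> \<psi> m"
    and sum_le: "\<And>n x. 0 \<le> x \<Longrightarrow> (\<Sum>m<n. dual_apply (\<psi> m) x) \<le> dual_apply \<phi> x"
begin

text \<open>The \<open>\<ell>\<^sup>1\<close> norm of the image of \<open>x\<close> after removal of
  its first \<open>N\<close> coordinates.\<close>

definition series_tail :: "nat \<Rightarrow> 'a \<Rightarrow> real"
  where "series_tail N x = (\<Sum>m. \<bar>dual_apply (\<psi> (m + N)) x\<bar>)"

lemma summable_shift: "summable (\<lambda>m. \<bar>dual_apply (\<psi> (m + N)) x\<bar>)"
  using summable_abs_dual[OF nonneg sum_le, of x] by (rule summable_ignore_initial_segment)

lemma series_tail_split: "series_tail 0 x = (\<Sum>m<N. \<bar>dual_apply (\<psi> m) x\<bar>) + series_tail N x"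
  unfolding series_tail_def using suminf_split_initial_segment[OF summable_shift[of 0 x], of N] by simp

lemma series_tail_nonneg: "0 \<le> series_tail N x"
  unfolding series_tail_def by (rule suminf_nonneg[OF summable_shift]) simp

lemma series_tail_antimono: "M \<le> N \<Longrightarrow> series_tail N x \<le> series_tail M x"
  using series_tail_split[of x M] series_tail_split[of x N]
    sum_mono2[of "{..<N}" "{..<M}" "\<lambda>m. \<bar>dual_apply (\<psi> m) x\<bar>"] by simp

lemma series_tail_triangle: "series_tail N (x + y) \<le> series_tail N x + series_tail N y"
proof -
  have "series_tail N (x + y) \<le> (\<Sum>m. \<bar>dual_apply (\<psi> (m + N)) x\<bar> + \<bar>dual_apply (\<psi> (m + N)) y\<bar>)"
    unfolding series_tail_def
    by (intro suminf_le summable_shift summable_add) (simp add: abs_triangle_ineq)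
  also have "\<dots> = series_tail N x + series_tail N y"
    unfolding series_tail_def by (rule suminf_add[symmetric]; rule summable_shift)
  finally show ?thesis .
qed

lemma series_tail_mono:
  assumes "\<bar>x\<bar> \<le> c" shows "series_tail N x \<le> series_tail N c"
  unfolding series_tail_def
proof (rule suminf_le[OF _ summable_shift summable_shift])
  fix m
  have "\<bar>dual_apply (\<psi> (m + N)) x\<bar> \<le> dual_apply (\<psi> (m + N)) \<bar>x\<bar>"
    by (rule dual_abs_le[OF nonneg])
  also have "\<dots> \<le> dual_apply (\<psi> (m + N)) c" by (rule dual_mono[OF nonneg assms])
  finally show "\<bar>dual_apply (\<psi> (m + N)) x\<bar> \<le> \<bar>dual_apply (\<psi> (m + N)) c\<bar>" by simp
qed

lemma series_tail_small: "0 < d \<Longrightarrow> \<exists>N. \<forall>n\<ge>N. series_tail n x < d"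
  using suminf_exist_split[OF _ summable_shift[of 0 x], of d] series_tail_nonneg
  by (simp add: series_tail_def)

text \<open>Schur's gliding hump argument, applied to the map \<open>x \<mapsto> (\<psi> m x)\<^sub>m\<close> into \<open>\<ell>\<^sup>1\<close>. No
  weakly convergent subsequence is available without the Eberlein--Smulian theorem; two cluster
  points take its place, and the coordinates force the same value of the test functional on them.\<close>
lemma series_tail_uniformly_small:
  assumes A: "relatively_weakly_compact A" and e: "0 < e"
  shows "\<exists>N. \<forall>x\<in>A. series_tail N x \<le> 6 * e"
proof (rule ccontr)
  assume "\<not> ?thesis"
  then have "\<forall>k. \<exists>x. x \<in> A \<and> 6 * e < series_tail k x" by (auto simp: not_le)
  from choice[OF this] obtain z where z: "\<And>k. z k \<in> A" "\<And>k. 6 * e < series_tail k (z k)" by blast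
  from relatively_weakly_compact_cluster[OF A, of z, OF z(1)] obtain x
    where "\<forall>\<Phi> d N. finite \<Phi> \<longrightarrow> 0 < d \<longrightarrow> (\<exists>k\<ge>N. \<forall>\<phi>\<in>\<Phi>. \<bar>dual_apply \<phi> (z k - x)\<bar> < d)"
    by (elim exE) (rule that)
  note x = this[rule_format]
  define w where "w k = z k - x" for k
  obtain N0 where N0: "\<And>n. N0 \<le> n \<Longrightarrow> series_tail n x < e" using series_tail_small[OF e] by blast
  \<comment> \<open>The slack in \<open>6 * e\<close>: the tail of \<open>x\<close> costs one
    \<open>e\<close> here. The coordinates before and after a block cost two more, and another two
    when signs are inserted; \<open>e\<close> remains.\<close>
  have w_large: "5 * e < series_tail k (w k)" if "N0 \<le> k" for k
    using series_tail_triangle[of k "w k" x] z(2)[of k] N0[OF that] by (simp add: w_def)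
  \<comment> \<open>The block from \<open>N\<close> to \<open>N'\<close> carries most of the norm of
    \<open>w k\<close>. The bound \<open>e / (real N + 1)\<close> makes the \<open>N\<close> earlier
    coordinates sum to at most \<open>e\<close>.\<close>
  define P where "P = (\<lambda>(k, N, N'). N0 \<le> N \<and> N \<le> k \<and> N < N' \<and> series_tail N' (w k) < e \<and>
    (\<forall>m<N. \<bar>dual_apply (\<psi> m) (w k)\<bar> < e / (real N + 1)))"
  have step: "\<exists>k N'. P (k, N, N')" if "N0 \<le> N" for N
  proof -
    obtain k where k: "N \<le> k" "\<forall>\<phi>\<in>\<psi> ` {..<N}. \<bar>dual_apply \<phi> (z k - x)\<bar> < e / (real N + 1)"
      using x[of "\<psi> ` {..<N}" "e / (real N + 1)" N] e by (auto simp del: dual_apply_linear)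
    obtain N' where N': "\<And>n. N' \<le> n \<Longrightarrow> series_tail n (w k) < e" using series_tail_small[OF e] by blast
    have "P (k, N, max N' (Suc N))"
      using k that N'[of "max N' (Suc N)"] by (simp add: P_def w_def)
    then show ?thesis by blast
  qed
  have "\<exists>h. \<forall>n. P (h n) \<and> fst (snd (h (Suc n))) = snd (snd (h n))"
  proof (rule dependent_nat_choice)
    show "\<exists>h. P h" using step[of N0] by blast
    fix h and n :: nat assume "P h"
    then have "N0 \<le> snd (snd h)" by (auto simp: P_def)
    from step[OF this] show "\<exists>h'. P h' \<and> fst (snd h') = snd (snd h)" by force
  qed
  then obtain h where h: "\<And>n. P (h n)" "\<And>n. fst (snd (h (Suc n))) = snd (snd (h n))" by blast
  define K where "K j = fst (h j)" for j
  define N where "N j = fst (snd (h j))" for j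
  have hj: "h j = (K j, N j, N (Suc j))" for j by (simp add: K_def N_def h(2))
  have P: "N0 \<le> N j" "N j \<le> K j" "N j < N (Suc j)" "series_tail (N (Suc j)) (w (K j)) < e"
    "\<And>m. m < N j \<Longrightarrow> \<bar>dual_apply (\<psi> m) (w (K j))\<bar> < e / (real (N j) + 1)" for j
    using h(1)[of j] by (simp_all add: P_def hj)
  have mono: "strict_mono N" using P(3) by (simp add: strict_mono_Suc_iff)
  have N_ge: "j \<le> N j" for j by (rule strict_mono_imp_increasing[OF mono])
  have head: "(\<Sum>m<N j. \<bar>dual_apply (\<psi> m) (w (K j))\<bar>) \<le> e" for j
  proof -
    have "(\<Sum>m<N j. \<bar>dual_apply (\<psi> m) (w (K j))\<bar>) \<le> (\<Sum>m<N j. e / (real (N j) + 1))"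
      by (intro sum_mono less_imp_le P(5)) simp
    also have "\<dots> \<le> e" using e by (simp add: field_simps)
    finally show ?thesis .
  qed
  \<comment> \<open>The block that contains the coordinate \<open>m\<close>. Coordinates before the
    first block get 0; only \<open>\<bar>b m\<bar> \<le> 1\<close> matters for them.\<close>
  define J where "J m = (LEAST j. m < N (Suc j))" for m
  have J: "J m = j" if "N j \<le> m" "m < N (Suc j)" for m j
    unfolding J_def
  proof (rule Least_equality)
    show "m < N (Suc j)" by (rule that(2))
    fix i assume "m < N (Suc i)"
    with that(1) have "N j < N (Suc i)" by simp
    then show "j \<le> i" using strict_mono_less[OF mono] by auto
  qed
  \<comment> \<open>On each block the signs of the corresponding \<open>w (K j)\<close>, so that one
    functional \<Psi> is large at all of them.\<close>
  define b where "b m = sgn (dual_apply (\<psi> m) (w (K (J m))))" for m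
  have b: "\<bar>b m\<bar> \<le> 1" for m by (simp add: b_def sgn_if)
  define \<Psi> where "\<Psi> = dual_series \<psi> b"
  have \<Psi>: "dual_apply \<Psi> y = (\<Sum>m. dual_apply (\<psi> m) y * b m)" for y
    unfolding \<Psi>_def by (rule dual_series_apply[OF nonneg sum_le b])
  have big: "e \<le> dual_apply \<Psi> (w (K j))" for j
  proof -
    let ?a = "\<lambda>m. dual_apply (\<psi> m) (w (K j))"
    have ge: "- \<bar>?a m\<bar> \<le> ?a m * b m" for m
      using b[of m] mult_left_le[of "\<bar>b m\<bar>" "\<bar>?a m\<bar>"] abs_mult[of "?a m" "b m"] by linarith
    have sm: "summable (\<lambda>m. ?a m * b m)"
      using bounded_linear_series(1)[OF nonneg sum_le, of b] b by simp
    have "- series_tail (N (Suc j)) (w (K j)) = (\<Sum>m. - \<bar>?a (m + N (Suc j))\<bar>)"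
      unfolding series_tail_def by (rule suminf_minus[OF summable_shift, symmetric])
    also have "\<dots> \<le> (\<Sum>m. ?a (m + N (Suc j)) * b (m + N (Suc j)))"
      by (intro suminf_le ge summable_minus summable_shift
          summable_ignore_initial_segment[OF sm])
    finally have t: "- e \<le> (\<Sum>m. ?a (m + N (Suc j)) * b (m + N (Suc j)))"
      using P(4)[of j] by linarith
    have blk: "?a m * b m = \<bar>?a m\<bar>" if "N j \<le> m" "m < N (Suc j)" for m
      using J[OF that] by (simp add: b_def abs_sgn)
    have split: "(\<Sum>m<N (Suc j). q m) = (\<Sum>m<N j. q m) + (\<Sum>m=N j..<N (Suc j). q m)" for q :: "nat \<Rightarrow> real"
      using P(3)[of j] by (simp add: lessThan_atLeast0 sum.atLeastLessThan_concat)
    have "- e \<le> (\<Sum>m<N j. - \<bar>?a m\<bar>)" using head[of j] by (simp add: sum_negf)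
    also have "\<dots> \<le> (\<Sum>m<N j. ?a m * b m)" by (intro sum_mono ge)
    finally have hd: "- e \<le> (\<Sum>m<N j. ?a m * b m)" .
    have "(\<Sum>m=N j..<N (Suc j). ?a m * b m) = (\<Sum>m=N j..<N (Suc j). \<bar>?a m\<bar>)"
      by (intro sum.cong blk) auto
    moreover have "5 * e < series_tail 0 (w (K j))"
      using w_large[of "K j"] series_tail_antimono[of 0 "K j" "w (K j)"] P(1,2)[of j] by linarith
    ultimately have "3 * e \<le> (\<Sum>m=N j..<N (Suc j). ?a m * b m)"
      using series_tail_split[of "w (K j)" "N (Suc j)"] split[of "\<lambda>m. \<bar>?a m\<bar>"] head[of j] P(4)[of j] by linarith
    moreover have "dual_apply \<Psi> (w (K j)) =
        (\<Sum>m. ?a (m + N (Suc j)) * b (m + N (Suc j))) + (\<Sum>m<N (Suc j). ?a m * b m)"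
      unfolding \<Psi> by (rule suminf_split_initial_segment[OF sm])
    ultimately show ?thesis using t hd split[of "\<lambda>m. ?a m * b m"] e by linarith
  qed
  from relatively_weakly_compact_cluster[OF A, of "\<lambda>j. z (K j)", OF z(1)] obtain y
    where "\<forall>\<Phi> d N. finite \<Phi> \<longrightarrow> 0 < d \<longrightarrow> (\<exists>j\<ge>N. \<forall>\<phi>\<in>\<Phi>. \<bar>dual_apply \<phi> (z (K j) - y)\<bar> < d)"
    by (elim exE) (rule that)
  note y = this[rule_format]
  \<comment> \<open>Each coordinate of \<open>w (K j)\<close> tends to 0, so the second cluster
    point \<open>y\<close> has the coordinates of \<open>x\<close>. As \<Psi> sees only coordinates,
    it cannot tell \<open>y\<close> from \<open>x\<close>.\<close>
  have coord: "dual_apply (\<psi> m) y = dual_apply (\<psi> m) x" for m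
  proof (rule ccontr)
    assume neq: "dual_apply (\<psi> m) y \<noteq> dual_apply (\<psi> m) x"
    define d where "d = \<bar>dual_apply (\<psi> m) y - dual_apply (\<psi> m) x\<bar> / 2"
    have d: "0 < d" using neq by (simp add: d_def)
    obtain n where n: "e / d < real n" using reals_Archimedean2 by blast
    obtain j where j: "max n (Suc m) \<le> j" "\<bar>dual_apply (\<psi> m) (z (K j) - y)\<bar> < d"
      using y[of "{\<psi> m}" d "max n (Suc m)"] d by auto
    have "m < N j" "real n \<le> real (N j)" using j(1) N_ge[of j] by auto
    then have "\<bar>dual_apply (\<psi> m) (w (K j))\<bar> < e / (real (N j) + 1)" by (intro P(5))
    also have "e / (real (N j) + 1) \<le> d"
    proof -
      have "e / d \<le> real (N j) + 1" using n \<open>real n \<le> real (N j)\<close> by linarith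
      then show ?thesis using d by (simp add: field_simps)
    qed
    finally have "\<bar>dual_apply (\<psi> m) (z (K j)) - dual_apply (\<psi> m) x\<bar> < d" by (simp add: w_def)
    moreover have "\<bar>dual_apply (\<psi> m) (z (K j)) - dual_apply (\<psi> m) y\<bar> < d" using j(2) by simp
    moreover have "2 * d = \<bar>dual_apply (\<psi> m) y - dual_apply (\<psi> m) x\<bar>" by (simp add: d_def)
    ultimately show False by linarith
  qed
  then have "dual_apply \<Psi> y = dual_apply \<Psi> x" by (simp add: \<Psi>)
  moreover obtain j where "\<bar>dual_apply \<Psi> (z (K j) - y)\<bar> < e"
    using y[of "{\<Psi>}" e 0] e by auto
  ultimately have "dual_apply \<Psi> (w (K j)) < e" by (simp add: w_def)
  then show False using big[of j] by simp
qed

text \<open>The factorisation through \<open>\<ell>\<^sup>1\<close>: the \<open>m\<close>-th unit vector is sent to \<open>y m\<close>.\<close>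
definition series_op :: "(nat \<Rightarrow> 'c::banach_lattice) \<Rightarrow> 'a \<Rightarrow>\<^sub>L 'c"
  where "series_op y = Blinfun (\<lambda>x. \<Sum>m. dual_apply (\<psi> m) x *\<^sub>R y m)"

context
  fixes y :: "nat \<Rightarrow> 'c::banach_lattice"
  assumes y: "\<And>m. norm (y m) \<le> 1"
begin

lemma series_op_apply: "blinfun_apply (series_op y) x = (\<Sum>m. dual_apply (\<psi> m) x *\<^sub>R y m)"
  unfolding series_op_def
  by (simp add: bounded_linear_Blinfun_apply bounded_linear_series(2)[OF nonneg sum_le y])

lemma dual_apply_series_op:
  "(\<lambda>m. dual_apply (\<psi> m) x * dual_apply f (y m)) sums dual_apply f (blinfun_apply (series_op y) x)"
  using bounded_linear.sums[OF bounded_linear_dual_apply[of f]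
      summable_sums[OF bounded_linear_series(1)[OF nonneg sum_le y]], of x]
  by (simp add: series_op_apply)

text \<open>The tail of the series for \<open>f n (T x)\<close> is controlled by the norm bound on
  \<open>f n\<close> and the uniformly small tails. In the finite head every
  \<open>f n (y m)\<close> tends to 0 while the coordinates stay bounded on
  \<open>A\<close>.\<close>

lemma almost_DP_series_op:
  assumes bd: "\<And>m. \<exists>B. \<forall>x\<in>A. \<bar>dual_apply (\<psi> m) x\<bar> \<le> B"
    and small: "\<And>e. 0 < e \<Longrightarrow> \<exists>N. \<forall>x\<in>A. series_tail N x \<le> e"
  shows "almost_DP_set (blinfun_apply (series_op y) ` A)"
  unfolding almost_DP_set_def
proof (intro allI impI)
  fix f :: "nat \<Rightarrow> 'c dual_space" assume "weakly_null f"
  note null = weakly_null_apply[OF this]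
  obtain M where M: "0 < M" "\<And>n. norm (f n) \<le> M"
    using pointwise_null_imp_norm_bounded[OF null] by blast
  show "uniform_limit (blinfun_apply (series_op y) ` A) (\<lambda>n. dual_apply (f n)) (\<lambda>_. 0) sequentially"
  proof (rule uniform_limitI)
    fix e :: real assume e: "0 < e"
    obtain N where N: "\<And>x. x \<in> A \<Longrightarrow> series_tail N x \<le> e / (2 * M)"
      using small[of "e / (2 * M)"] e M(1) by auto
    obtain B where B: "\<And>m x. x \<in> A \<Longrightarrow> \<bar>dual_apply (\<psi> m) x\<bar> \<le> B m"
      using bd by metis
    have "(\<lambda>n. \<Sum>m<N. B m * \<bar>dual_apply (f n) (y m)\<bar>) \<longlonglongrightarrow> (\<Sum>m<N. B m * 0)"
      by (intro tendsto_sum tendsto_mult tendsto_const tendsto_rabs_zero null)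
    then have "\<forall>\<^sub>F n in sequentially. (\<Sum>m<N. B m * \<bar>dual_apply (f n) (y m)\<bar>) < e / 2"
      using e by (intro order_tendstoD(2)) auto
    then show "\<forall>\<^sub>F n in sequentially. \<forall>v\<in>blinfun_apply (series_op y) ` A. dist (dual_apply (f n) v) 0 < e"
    proof eventually_elim
      case (elim n)
      have "\<bar>dual_apply (f n) (blinfun_apply (series_op y) x)\<bar> < e" if x: "x \<in> A" for x
      proof -
        let ?p = "\<lambda>m. dual_apply (\<psi> m) x * dual_apply (f n) (y m)"
        have sm: "summable ?p" and eq: "dual_apply (f n) (blinfun_apply (series_op y) x) = (\<Sum>m. ?p m)"
          using dual_apply_series_op[of x "f n"] by (simp_all add: sums_iff)
        have fy: "\<bar>dual_apply (f n) (y m)\<bar> \<le> M" for m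
          using dual_le_norm[OF y, of "f n" m] M(2)[of n] by linarith
        have le: "norm (?p (m + N)) \<le> \<bar>dual_apply (\<psi> (m + N)) x\<bar> * M" for m
          using fy by (simp add: abs_mult mult_left_mono)
        have smM: "summable (\<lambda>m. \<bar>dual_apply (\<psi> (m + N)) x\<bar> * M)"
          by (rule summable_mult2[OF summable_shift])
        have "norm (\<Sum>m. ?p (m + N)) \<le> (\<Sum>m. \<bar>dual_apply (\<psi> (m + N)) x\<bar> * M)"
          by (rule norm_suminf_le[OF le smM])
        also have "\<dots> = series_tail N x * M"
          unfolding series_tail_def by (rule suminf_mult2[OF summable_shift, symmetric])
        also have "\<dots> \<le> e / (2 * M) * M"
          using N[OF x] M(1) by (intro mult_right_mono) auto
        also have "\<dots> = e / 2" using M(1) by simp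
        finally have t: "\<bar>\<Sum>m. ?p (m + N)\<bar> \<le> e / 2" by simp
        have "\<bar>\<Sum>m<N. ?p m\<bar> \<le> (\<Sum>m<N. \<bar>?p m\<bar>)" by (rule sum_abs)
        also have "\<dots> \<le> (\<Sum>m<N. B m * \<bar>dual_apply (f n) (y m)\<bar>)"
          by (intro sum_mono) (simp add: abs_mult mult_right_mono B[OF x])
        also have "\<dots> < e / 2" by (rule elim)
        finally show ?thesis
          using t suminf_split_initial_segment[OF sm, of N] unfolding eq by linarith
      qed
      then show ?case by auto
    qed
  qed
qed

lemma weak_and_almost_DP_series_op: "weak_and_almost_DP (series_op y)"
  unfolding weak_and_almost_DP_def
proof (intro allI impI)
  fix A :: "'a set" assume A: "relatively_weakly_compact A"
  show "almost_DP_set (blinfun_apply (series_op y) ` A)"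
  proof (rule almost_DP_series_op)
    show "\<exists>B. \<forall>x\<in>A. \<bar>dual_apply (\<psi> m) x\<bar> \<le> B" for m
      by (rule relatively_weakly_compact_bounded_functional[OF A])
    show "\<exists>N. \<forall>x\<in>A. series_tail N x \<le> e" if "0 < e" for e
      using series_tail_uniformly_small[OF A, of "e / 6"] that by simp
  qed
qed

lemma order_almost_DP_series_op: "order_almost_DP (series_op y)"
  unfolding order_almost_DP_def
proof (intro allI impI)
  fix A :: "'a set" assume "order_bounded A"
  then obtain a b where ab: "A \<subseteq> {a..b}" by (auto simp: order_bounded_def)
  \<comment> \<open>One vector dominating the moduli of all members of \<open>A\<close>, so its
    tails dominate theirs.\<close>
  define c where "c = \<bar>a\<bar> + \<bar>b\<bar>"
  have c: "\<bar>x\<bar> \<le> c" if "x \<in> A" for x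
  proof -
    have "a \<le> x" "x \<le> b" using ab that by auto
    then have "x \<le> \<bar>b\<bar>" "- x \<le> \<bar>a\<bar>"
      using abs_ge_self[of b] abs_ge_minus_self[of a] by (meson neg_le_iff_le order_trans)+
    then have "x \<le> c" "- x \<le> c"
      unfolding c_def by (simp_all add: add_increasing add_increasing2)
    then show ?thesis by (simp add: abs_lattice)
  qed
  show "almost_DP_set (blinfun_apply (series_op y) ` A)"
  proof (rule almost_DP_series_op)
    fix m
    have "\<bar>dual_apply (\<psi> m) x\<bar> \<le> dual_apply (\<psi> m) c" if "x \<in> A" for x
      using dual_abs_le[OF nonneg] dual_mono[OF nonneg c[OF that]] by (rule order_trans)
    then show "\<exists>B. \<forall>x\<in>A. \<bar>dual_apply (\<psi> m) x\<bar> \<le> B" by blast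
  next
    fix e :: real assume "0 < e"
    then obtain N where N: "\<forall>n\<ge>N. series_tail n c < e" using series_tail_small by blast
    have "series_tail N x \<le> e" if "x \<in> A" for x
      using series_tail_mono[OF c[OF that], of N] N by (meson less_imp_le order_refl order_trans)
    then show "\<exists>N. \<forall>x\<in>A. series_tail N x \<le> e" by blast
  qed
qed

end

end

text \<open>The component at \<open>u m\<close> vanishes at the other \<open>u n\<close>, so
  \<open>T\<close> sends \<open>u n\<close> to \<open>\<phi> (u n) *\<^sub>R y n\<close>, where
  \<open>h n\<close> is at least \<open>d * e\<close>.\<close>

lemma exists_not_almost_weakly_limited:
  assumes "\<not> order_continuous_norm TYPE('e::banach_lattice dual_space)"
    and "\<not> positive_schur TYPE('f::banach_lattice dual_space)"
  shows "\<exists>T :: 'e \<Rightarrow>\<^sub>L 'f. order_almost_DP T \<and> weak_and_almost_DP T \<and> \<not> almost_weakly_limited T"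
proof -
  from not_order_continuous_dual[OF assms(1)]
  obtain \<phi> and u :: "nat \<Rightarrow> 'e" and d where \<phi>: "0 \<le> \<phi>" and d: "0 < d"
    and u: "\<And>n. 0 \<le> u n" "\<And>n. norm (u n) \<le> 1" "\<And>n. d \<le> dual_apply \<phi> (u n)"
      "\<And>m n. m \<noteq> n \<Longrightarrow> inf (u m) (u n) = 0"
    by blast
  from not_positive_schur_dual[OF assms(2)]
  obtain h :: "nat \<Rightarrow> 'f dual_space" and y e where h: "disjoint_seq h" "weakly_null h" and e: "0 < e"
    and y: "\<And>n. norm (y n) \<le> 1" "\<And>n. e \<le> dual_apply (h n) (y n)"
    by blast
  define \<psi> where "\<psi> m = dual_comp \<phi> (u m)" for m
  have \<psi>: "\<And>m. 0 \<le> \<psi> m" "\<And>n x. 0 \<le> x \<Longrightarrow> (\<Sum>m<n. dual_apply (\<psi> m) x) \<le> dual_apply \<phi> x"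
    by (auto simp: \<psi>_def dual_comp_nonneg \<phi> u intro!: sum_dual_comp_le)
  define T where "T = series_op \<psi> y"
  have "d * e \<le> dual_apply (h n) (blinfun_apply T (u n))" for n
  proof -
    have "dual_apply (\<psi> m) (u n) * dual_apply (h n) (y m) =
        (if m = n then dual_apply \<phi> (u n) * dual_apply (h n) (y n) else 0)" for m
      using dual_comp_disjoint[OF \<phi> u(1,1) u(4), of n m]
      by (auto simp: \<psi>_def dual_comp_self \<phi> u)
    then have "(\<lambda>m. if m = n then dual_apply \<phi> (u n) * dual_apply (h n) (y n) else 0) sums
        dual_apply (h n) (blinfun_apply T (u n))"
      using dual_apply_series_op[where y = y, OF \<psi> y(1), of "u n" "h n"] by (simp add: T_def)
    then have "dual_apply (h n) (blinfun_apply T (u n)) = dual_apply \<phi> (u n) * dual_apply (h n) (y n)"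
      using sums_unique2 sums_single[of n "\<lambda>_. dual_apply \<phi> (u n) * dual_apply (h n) (y n)"] by blast
    also have "d * e \<le> \<dots>" using u(3)[of n] y(2)[of n] d e by (intro mult_mono) auto
    finally show ?thesis .
  qed
  then have far: "d * e \<le> \<bar>dual_apply (h n) (blinfun_apply T (u n))\<bar>" for n
    by (meson abs_ge_self order_trans)
  have "\<not> almost_weakly_limited T"
  proof
    assume "almost_weakly_limited T"
    then have "uniform_limit (blinfun_apply T ` cball 0 1) (\<lambda>n. dual_apply (h n)) (\<lambda>_. 0) sequentially"
      using h by (simp add: almost_weakly_limited_def almost_DP_set_def)
    then have "\<forall>\<^sub>F n in sequentially. \<forall>v\<in>blinfun_apply T ` cball 0 1. dist (dual_apply (h n) v) 0 < d * e"
      using d e by (intro uniform_limitD) auto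
    then obtain n where "\<forall>v\<in>blinfun_apply T ` cball 0 1. dist (dual_apply (h n) v) 0 < d * e"
      by (auto simp: eventually_sequentially)
    then have "\<bar>dual_apply (h n) (blinfun_apply T (u n))\<bar> < d * e"
      using u(2)[of n] by simp
    then show False using far[of n] by simp
  qed
  moreover have "order_almost_DP T" "weak_and_almost_DP T"
    unfolding T_def
    by (rule order_almost_DP_series_op[OF \<psi> y(1)] weak_and_almost_DP_series_op[OF \<psi> y(1)]; assumption)+
  ultimately show ?thesis by blast
qed

theorem theorem2p22:
  shows "(\<forall>T :: 'e::banach_lattice \<Rightarrow>\<^sub>L 'f::banach_lattice.
            order_almost_DP T \<and> weak_and_almost_DP T \<longrightarrow> almost_weakly_limited T)
         \<longleftrightarrow> order_continuous_norm TYPE('e dual_space) \<or> positive_schur TYPE('f dual_space)"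
  using exists_not_almost_weakly_limited[where 'e = 'e and 'f = 'f]
    order_continuous_imp_almost_weakly_limited[where 'e = 'e and 'f = 'f]
    positive_schur_imp_almost_weakly_limited[where 'e = 'e and 'f = 'f]
  by blast

end
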